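(* Let $X=\{X_n,n\ge0\}$ be a time-homogeneous Markov chain on $\mathbb{R}^+$ with jumps $\xi(x)$ and jump moments $m_1(x),m_2(x)$. Suppose that $m_1(x)\sim\mu/x$ and $m_2(x)\to b>0$ as $x\to\infty$, where $2\mu>b$. Suppose further that: (i) for some $\delta>0$ and $\gamma\in(0,1)$ satisfying $(1+\delta)/(1-\gamma)^{2+\delta}<2\mu/b$, $$\mathbb{P}\{\xi(x)\le-\gamma x\}=o\Bigl(\frac{m_2(x)}{x^{2+\delta}}\Bigr)\qquad\text{as }x\to\infty;$$ (ii) for some $x_0\ge0$, $\varepsilon_0\ge0$ and $\varepsilon>0$, $$2x\,m_1(x)+m_2(x)\ge\begin{cases}\varepsilon,&\text{if }x>x_0,\\-\varepsilon_0,&\text{if }x\le x_0;\end{cases}$$ (iii) with the same $x_0$, $\displaystyle\sup_{y\le x_0}\sum_{n=0}^\infty\mathbb{P}_y\{X_n\le x_0\}<\infty$; (iv) there is a random variable $\Xi$ with $\mathbb{E}\Xi<\infty$ such that $\xi^2(x)\le_{st}\Xi$ for all $x$. Then, for any initial distribution of the chain $X$, $$H(x):=\sum_{n=0}^\infty\mathbb{P}\{X_n\le x\}\sim\frac{x^2}{2\mu-b}\qquad\text{as }x\to\infty.$$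
   Context: $\xi(x)$ denotes a random variable distributed as the jump of the chain from the state $x\in\mathbb{R}^+$, i.e. $\mathbb{P}\{\xi(x)\in D\}=\mathbb{P}\{X_{n+1}-X_n\in D\mid X_n=x\}$ for Borel $D$; $m_k(x):=\mathbb{E}\xi^k(x)$; $\mathbb{P}_y$ refers to the chain started at $X_0=y$. The relation $\eta\le_{st}\Xi$ means $\mathbb{P}\{\eta>t\}\le\mathbb{P}\{\Xi>t\}$ for all $t$; $f(x)\sim g(x)$ means $f(x)/g(x)\to1$. *)

theory Defs
  imports "HOL-Probability.Probability" "HOL-Library.Landau_Symbols"
begin

abbreviation Rplus :: "real measure" where
  "Rplus \<equiv> restrict_space borel {0..}"

definition history :: "'a measure \<Rightarrow> (nat \<Rightarrow> 'a \<Rightarrow> real) \<Rightarrow> nat \<Rightarrow> 'a measure" where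
  "history M X n =
     vimage_algebra (space M) (\<lambda>\<omega>. \<lambda>i\<in>{..n}. X i \<omega>) (PiM {..n} (\<lambda>_. Rplus))"

(* X is a time-homogeneous Markov chain with respect to its natural filtration, with state space
   [0, \<infinity>) and one-step transition kernel K: P(X_{n+1} \<in> A | X_0, ..., X_n) = K(X_n, A) a.s.
   The distribution of X 0 is arbitrary. *)
definition markov_chain :: "'a measure \<Rightarrow> (real \<Rightarrow> real measure) \<Rightarrow> (nat \<Rightarrow> 'a \<Rightarrow> real) \<Rightarrow> bool" where
  "markov_chain M K X \<longleftrightarrow>
     prob_space M \<and>
     K \<in> Rplus \<rightarrow>\<^sub>M prob_algebra Rplus \<and>
     (\<forall>n. X n \<in> M \<rightarrow>\<^sub>M Rplus) \<and>
     (\<forall>n. \<forall>A\<in>sets Rplus. AE \<omega> in M.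
        real_cond_exp M (history M X n) (indicator (X (Suc n) -` A \<inter> space M)) \<omega>
          = measure (K (X n \<omega>)) A)"

(* The n-step transition kernel: law_from K n y is the distribution of X_n under P_y, that is, for
   the chain started at X_0 = y; see markov_chain_distr_start below. *)
primrec law_from :: "(real \<Rightarrow> real measure) \<Rightarrow> nat \<Rightarrow> real \<Rightarrow> real measure" where
  "law_from K 0 y = return Rplus y"
| "law_from K (Suc n) y = law_from K n y \<bind> K"

(* The distribution of the jump \<xi>(x). *)
definition jump_law :: "(real \<Rightarrow> real measure) \<Rightarrow> real \<Rightarrow> real measure" where
  "jump_law K x = distr (K x) borel (\<lambda>z. z - x)"

definition jump_moment :: "(real \<Rightarrow> real measure) \<Rightarrow> nat \<Rightarrow> real \<Rightarrow> real" where
  "jump_moment K k x = (\<integral>z. z ^ k \<partial>jump_law K x)"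

definition st_le :: "'a measure \<Rightarrow> ('a \<Rightarrow> real) \<Rightarrow> 'b measure \<Rightarrow> ('b \<Rightarrow> real) \<Rightarrow> bool" where
  "st_le M f N g \<longleftrightarrow>
     (\<forall>t. measure M {\<omega> \<in> space M. f \<omega> > t} \<le> measure N {\<omega> \<in> space N. g \<omega> > t})"

(* Takes the value \<infinity> if the series diverges. Since enn2real \<infinity> = 0, an asymptotic equivalence of
   enn2real (renewal_fun M X x) with a positive function entails that the series converges for all
   large x, and hence for all x by monotonicity. *)
definition renewal_fun :: "'a measure \<Rightarrow> (nat \<Rightarrow> 'a \<Rightarrow> real) \<Rightarrow> real \<Rightarrow> ennreal" where
  "renewal_fun M X x = (\<Sum>n. emeasure M {\<omega> \<in> space M. X n \<omega> \<le> x})"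

lemma subalgebra_history:
  assumes "markov_chain M K X"
  shows "subalgebra M (history M X n)"
proof -
  have m: "\<And>i. X i \<in> M \<rightarrow>\<^sub>M Rplus"
    using assms by (simp add: markov_chain_def)
  have "(\<lambda>\<omega>. \<lambda>i\<in>{..n}. X i \<omega>) \<in> M \<rightarrow>\<^sub>M PiM {..n} (\<lambda>_. Rplus)"
    by (rule measurable_restrict) (rule m)
  then have "sets (history M X n) \<subseteq> sets M"
    unfolding history_def
    by (intro sets_vimage_algebra2[THEN ord_eq_le_trans])
       (auto dest: measurable_space measurable_sets)
  then show ?thesis
    by (simp add: subalgebra_def history_def)
qed

lemma markov_chain_distr_Suc:
  assumes mc: "markov_chain M K X"
  shows "distr M Rplus (X (Suc n)) = distr M Rplus (X n) \<bind> K"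
proof -
  interpret prob_space M using mc by (simp add: markov_chain_def)
  have K: "K \<in> Rplus \<rightarrow>\<^sub>M prob_algebra Rplus" and X: "\<And>i. X i \<in> M \<rightarrow>\<^sub>M Rplus"
    using mc by (auto simp: markov_chain_def)
  have Ksub: "K \<in> Rplus \<rightarrow>\<^sub>M subprob_algebra Rplus"
    using K by (rule measurable_prob_algebraD)
  interpret H: finite_measure_subalgebra M "history M X n"
    by standard (rule subalgebra_history[OF mc])
  have sp: "space (distr M Rplus (X n)) \<noteq> {}"
    by (simp add: space_restrict_space)
  have sets_bind: "sets (distr M Rplus (X n) \<bind> K) = sets Rplus"
    by (rule sets_bind[OF _ sp])
       (use K in \<open>auto dest!: measurable_space simp: space_prob_algebra\<close>)
  show ?thesis
  proof (rule measure_eqI)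
    fix A assume "A \<in> sets (distr M Rplus (X (Suc n)))"
    then have A: "A \<in> sets Rplus" by simp
    let ?B = "X (Suc n) -` A \<inter> space M"
    have B: "?B \<in> sets M" using X A by (rule measurable_sets)
    have Kp: "prob_space (K (X n \<omega>))" if "\<omega> \<in> space M" for \<omega>
      using measurable_space[OF K measurable_space[OF X that]] by (simp add: space_prob_algebra)
    have km: "(\<lambda>\<omega>. measure (K (X n \<omega>)) A) \<in> borel_measurable M"
      using measurable_compose[OF X measurable_compose[OF Ksub measurable_measure_subprob_algebra]] A
      by simp
    have ae: "AE \<omega> in M. real_cond_exp M (history M X n) (indicator ?B) \<omega> = measure (K (X n \<omega>)) A"
      using mc A by (auto simp: markov_chain_def)
    have "prob ?B = (\<integral>\<omega>. indicator ?B \<omega> \<partial>M)"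
      by simp
    also have "\<dots> = (\<integral>\<omega>. real_cond_exp M (history M X n) (indicator ?B) \<omega> \<partial>M)"
      using B by (intro H.real_cond_exp_int(2)[symmetric]) (auto intro!: integrable_real_indicator simp: emeasure_eq_measure)
    also have "\<dots> = (\<integral>\<omega>. measure (K (X n \<omega>)) A \<partial>M)"
      using ae km by (intro integral_cong_AE) auto
    finally have "emeasure M ?B = ennreal (\<integral>\<omega>. measure (K (X n \<omega>)) A \<partial>M)"
      by (simp add: emeasure_eq_measure)
    also have "\<dots> = (\<integral>\<^sup>+\<omega>. ennreal (measure (K (X n \<omega>)) A) \<partial>M)"
      using km Kp
      by (intro nn_integral_eq_integral[symmetric] integrable_const_bound[where B = 1])
         (auto simp: prob_space.prob_le_1)
    also have "\<dots> = (\<integral>\<^sup>+\<omega>. emeasure (K (X n \<omega>)) A \<partial>M)"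
      using Kp
      by (intro nn_integral_cong)
         (auto simp: finite_measure.emeasure_eq_measure prob_space_def)
    also have "\<dots> = (\<integral>\<^sup>+x. emeasure (K x) A \<partial>distr M Rplus (X n))"
      using measurable_emeasure_kernel[OF Ksub A] by (intro nn_integral_distr[symmetric] X) simp
    also have "\<dots> = emeasure (distr M Rplus (X n) \<bind> K) A"
      using Ksub A by (intro emeasure_bind[OF sp, symmetric]) auto
    finally show "emeasure (distr M Rplus (X (Suc n))) A = emeasure (distr M Rplus (X n) \<bind> K) A"
      using X A by (simp add: emeasure_distr)
  qed (simp add: sets_bind)
qed

lemma markov_chain_distr_start:
  assumes mc: "markov_chain M K X" and y: "y \<ge> 0" and X0: "AE \<omega> in M. X 0 \<omega> = y"
  shows "distr M Rplus (X n) = law_from K n y"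
proof (induction n)
  case 0
  interpret prob_space M using mc by (simp add: markov_chain_def)
  have X: "X 0 \<in> M \<rightarrow>\<^sub>M Rplus"
    using mc by (auto simp: markov_chain_def)
  have "distr M Rplus (X 0) = distr M Rplus (\<lambda>_. y)"
    using X X0 y by (intro distr_cong_AE) (auto simp: space_restrict_space)
  also have "\<dots> = return Rplus y"
    using y by (intro distr_const) (simp add: space_restrict_space)
  finally show ?case by simp
next
  case (Suc n)
  then show ?case by (simp add: markov_chain_distr_Suc[OF mc])
qed

end

theory Submission
  imports Defs
begin

text \<open>
  The proof is potential theoretic. Let \<open>\<Gamma>\<close> be the Green measure,
  \<open>\<Gamma>(B) = \<Sum>\<^sub>n P(X\<^sub>n \<in> B)\<close>, so that \<open>H(x) = \<Gamma>[0, x]\<close>, and let \<open>L h (x) = E h(x + \<xi>(x)) - h(x)\<close>.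
  If \<open>h\<close> is bounded, \<open>L h\<close> is \<open>\<Gamma>\<close>-integrable and \<open>E h(X\<^sub>n) \<rightarrow> 0\<close>, then summing the increments of \<open>E h(X\<^sub>n)\<close> gives
  \<open>\<integral> L h d\<Gamma> = - E h(X\<^sub>0)\<close> (\<open>potential_identity\<close>). Everything is extracted from this identity by means
  of the test functions \<open>h\<^sub>a(x) = (s + x\<^sup>2)\<^bsup>-a\<^esup>\<close> with \<open>s \<rightarrow> \<infinity>\<close>.

  Their use is that \<open>L\<close> is close to the operator \<open>(\<mu>/x) h' + (b/2) h''\<close>, and this operator maps \<open>h\<^sub>a\<close> to
  \<open>- 2ab(q - a) h\<^bsub>a+1\<^esub> - 2a(a + 1)b s h\<^bsub>a+2\<^esub>\<close> with \<open>q = (2\<mu> - b)/(2b) > 0\<close>. Put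
  \<open>J\<^sub>a(s) = s\<^bsup>a\<^esup> \<integral> h\<^bsub>a+1\<^esub> d\<Gamma>\<close>. As \<open>s\<^bsup>a\<^esup> E h\<^sub>a(X\<^sub>0) \<rightarrow> 1\<close>, the identity becomes
  \<open>2ab(q - a) J\<^sub>a + 2a(a + 1)b J\<^bsub>a+1\<^esub> \<rightarrow> 1\<close> (\<open>J_relation\<close>). For \<open>a = q\<close> the first coefficient
  vanishes, which gives the limit of \<open>J\<^bsub>q+1\<^esub>\<close>; the relation then propagates it to
  \<open>J\<^bsub>q+1+j\<^esub> \<rightarrow> 1/(2bq(q + 1 + j))\<close> for all natural \<open>j\<close> (\<open>J_limit\<close>).
  In terms of \<open>w = s/(s + x\<^sup>2) \<in> (0, 1]\<close> these are the limits of all the moments of \<open>w\<close> under the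
  measure \<open>s\<^bsup>-1\<^esup> w\<^bsup>q+2\<^esup> d\<Gamma>\<close>, and they are the moments of \<open>u\<^bsup>q\<^esup> du/(2bq)\<close> on \<open>[0, 1]\<close>. By Karamata's argument
  (Weierstrass approximation, then a sandwich by continuous functions) the limit extends to the
  function \<open>w\<^bsup>-q-2\<^esup> 1{w \<ge> 1/2}\<close>. Since \<open>w \<ge> 1/2\<close> means \<open>x\<^sup>2 \<le> s\<close>, this says
  \<open>H(\<surd>s)/s \<rightarrow> 1/(2bq) = 1/(2\<mu> - b)\<close>.

  To replace \<open>L\<close> by its limit one needs the a priori bound \<open>\<integral> h\<^bsub>d+1\<^esub> d\<Gamma> = O(s\<^bsup>-d\<^esup>)\<close> for some \<open>d > 0\<close>
  (\<open>green_lyap_nn_bound\<close>), which also contains the transience of the chain. It holds because for small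
  \<open>d\<close> and all large \<open>s\<close> the function \<open>h\<^sub>d\<close> is itself a Lyapunov function outside \<open>[0, x\<^sub>0]\<close>
  (\<open>lyapunov_drift\<close>): for large \<open>x\<close> because \<open>d < q\<close>, and for the other \<open>x > x\<^sub>0\<close> by the condition \<open>drift\<close>, since
  \<open>h\<^sub>d\<close> is there nearly an affine decreasing function of \<open>x\<^sup>2\<close>. The time spent in \<open>[0, x\<^sub>0]\<close> is bounded by means
  of \<open>occupation\<close> (\<open>occupation_le\<close>). The condition \<open>domination\<close> makes the second-order expansion of \<open>h\<^sub>a\<close> uniform. The
  condition \<open>left_tail\<close> is needed because a long jump to the left, from far above \<open>\<surd>s\<close> into \<open>[0, \<surd>s]\<close>, can raise \<open>h\<^sub>a\<close> from a much
  smaller value to the order of its maximum \<open>s\<^bsup>-a\<^esup>\<close>; for \<open>2d \<le> \<delta>\<close> such jumps are rare enough to be absorbed by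
  \<open>h\<^bsub>d+1\<^esub>\<close> (\<open>left_prob_le_lyap\<close>).
\<close>

section \<open>Stochastic domination and truncated expectations\<close>

lemma nn_integral_tail_layer_cake:
  fixes f :: "'a \<Rightarrow> real"
  assumes "sigma_finite_measure P" and f[measurable]: "f \<in> borel_measurable P" and T: "T \<ge> 0"
  shows "(\<integral>\<^sup>+x. ennreal (f x * indicator {x. f x > T} x) \<partial>P)
       = (\<integral>\<^sup>+t. indicator {0..} t * emeasure P {x \<in> space P. f x > max t T} \<partial>lborel)"
proof -
  interpret sigma_finite_measure P by fact
  interpret pair_sigma_finite P lborel by standard
  have "ennreal (f x * indicator {x. f x > T} x)
      = (\<integral>\<^sup>+t. indicator {0..} t * indicator {x. f x > max t T} x \<partial>lborel)" for x
  proof -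
    have "(\<integral>\<^sup>+t. indicator {0..} t * indicator {x. f x > max t T} x \<partial>lborel)
        = (\<integral>\<^sup>+t. indicator (if f x > T then {0..<f x} else {}) t \<partial>(lborel :: real measure))"
      by (intro nn_integral_cong) (auto simp: indicator_def)
    also have "\<dots> = ennreal (f x * indicator {x. f x > T} x)"
      using T by (subst nn_integral_indicator) auto
    finally show ?thesis ..
  qed
  then have "(\<integral>\<^sup>+x. ennreal (f x * indicator {x. f x > T} x) \<partial>P)
     = (\<integral>\<^sup>+x. (\<integral>\<^sup>+t. indicator {0..} t * indicator {x. f x > max t T} x \<partial>lborel) \<partial>P)"
    by simp
  also have "\<dots> = (\<integral>\<^sup>+t. (\<integral>\<^sup>+x. indicator {0..} t * indicator {x. f x > max t T} x \<partial>P) \<partial>lborel)"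
    by (subst Fubini') (auto simp: indicator_def)
  also have "\<dots> = (\<integral>\<^sup>+t. indicator {0..} t * emeasure P {x \<in> space P. f x > max t T} \<partial>lborel)"
  proof (intro nn_integral_cong)
    fix t :: real
    have "(\<integral>\<^sup>+x. indicator {0..} t * indicator {x. f x > max t T} x \<partial>P)
        = indicator {0..} t * (\<integral>\<^sup>+x. indicator {x. f x > max t T} x \<partial>P)"
      by (intro nn_integral_cmult) auto
    also have "(\<integral>\<^sup>+x. indicator {x. f x > max t T} x \<partial>P)
        = (\<integral>\<^sup>+x. indicator {x \<in> space P. f x > max t T} x \<partial>P)"
      by (intro nn_integral_cong) (auto simp: indicator_def)
    finally show "(\<integral>\<^sup>+x. indicator {0..} t * indicator {x. f x > max t T} x \<partial>P)
        = indicator {0..} t * emeasure P {x \<in> space P. f x > max t T}"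
      by simp
  qed
  finally show ?thesis .
qed

text \<open>
  The layer cake formula writes both sides as integrals of tail probabilities, which the stochastic
  order compares. This is what turns \<open>domination\<close> into uniform integrability of the squared jumps.
\<close>

lemma st_le_tail_integral:
  fixes f :: "'a \<Rightarrow> real" and g :: "'b \<Rightarrow> real"
  assumes P: "prob_space P" and Q: "prob_space Q"
    and f[measurable]: "f \<in> borel_measurable P" and g: "integrable Q g"
    and le: "st_le P f Q g" and T: "T \<ge> 0"
  shows "integrable P (\<lambda>x. f x * indicator {x. f x > T} x)"
    and "(\<integral>x. f x * indicator {x. f x > T} x \<partial>P) \<le> (\<integral>y. g y * indicator {y. g y > T} y \<partial>Q)"
proof -
  interpret P: prob_space P by fact
  interpret Q: prob_space Q by fact
  have [measurable]: "g \<in> borel_measurable Q" using g by auto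
  have gT: "integrable Q (\<lambda>y. g y * indicator {y. g y > T} y)"
    by (rule Bochner_Integration.integrable_bound[OF g]) (auto simp: indicator_def)
  have "(\<integral>\<^sup>+x. ennreal (f x * indicator {x. f x > T} x) \<partial>P)
      \<le> (\<integral>\<^sup>+y. ennreal (g y * indicator {y. g y > T} y) \<partial>Q)"
    unfolding nn_integral_tail_layer_cake[OF P.sigma_finite_measure_axioms f T]
      nn_integral_tail_layer_cake[OF Q.sigma_finite_measure_axioms \<open>g \<in> borel_measurable Q\<close> T]
    using le[unfolded st_le_def, rule_format, of "max _ T"]
    by (intro nn_integral_mono mult_left_mono)
      (auto simp: P.emeasure_eq_measure Q.emeasure_eq_measure simp del: max_less_iff_conj)
  also have "\<dots> = ennreal (\<integral>y. g y * indicator {y. g y > T} y \<partial>Q)"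
    using T by (intro nn_integral_eq_integral gT) (auto simp: indicator_def)
  finally have *: "(\<integral>\<^sup>+x. ennreal (f x * indicator {x. f x > T} x) \<partial>P)
      \<le> ennreal (\<integral>y. g y * indicator {y. g y > T} y \<partial>Q)" .
  show int: "integrable P (\<lambda>x. f x * indicator {x. f x > T} x)"
    using T * by (intro integrableI_nonneg) (auto simp: indicator_def intro: le_less_trans)
  have "ennreal (\<integral>x. f x * indicator {x. f x > T} x \<partial>P) \<le> ennreal (\<integral>y. g y * indicator {y. g y > T} y \<partial>Q)"
    using * T by (subst nn_integral_eq_integral[OF int, symmetric]) (auto simp: indicator_def)
  moreover have "0 \<le> (\<integral>y. g y * indicator {y. g y > T} y \<partial>Q)"
    using T by (intro integral_nonneg_AE) (auto simp: indicator_def)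
  ultimately show "(\<integral>x. f x * indicator {x. f x > T} x \<partial>P) \<le> (\<integral>y. g y * indicator {y. g y > T} y \<partial>Q)"
    by simp
qed

lemma truncated_tail_tendsto_0:
  fixes g :: "'b \<Rightarrow> real"
  assumes g: "integrable Q g"
  shows "((\<lambda>T. \<integral>y. g y * indicator {y. g y > T} y \<partial>Q) \<longlongrightarrow> 0) at_top"
proof -
  have [measurable]: "g \<in> borel_measurable Q" using g by auto
  have "((\<lambda>T. \<integral>y. g y * indicator {y. g y > T} y \<partial>Q) \<longlongrightarrow> (\<integral>y. 0 \<partial>Q)) at_top"
  proof (rule integral_dominated_convergence_at_top[where w = "\<lambda>y. \<bar>g y\<bar>"])
    show "AE y in Q. ((\<lambda>T. g y * indicator {y. g y > T} y) \<longlongrightarrow> 0) at_top"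
    proof (intro AE_I2 tendsto_eventually)
      fix y show "\<forall>\<^sub>F T in at_top. g y * indicator {y. g y > T} y = 0"
        using eventually_ge_at_top[of "g y"] by eventually_elim (auto simp: indicator_def)
    qed
  qed (use g in \<open>auto simp: indicator_def\<close>)
  then show ?thesis by simp
qed

section \<open>Second-order expansion of the test functions\<close>

lemma powr_minus_taylor2:
  fixes a v :: real
  assumes a: "a > 0" and v: "\<bar>v\<bar> \<le> 1/2"
  shows "\<bar>(1 + v) powr (- a) - (1 - a * v + a * (a + 1) / 2 * v\<^sup>2)\<bar>
       \<le> a * (a + 1) * (a + 2) / 6 * 2 powr (a + 3) * \<bar>v\<bar> ^ 3"
proof (cases "v = 0")
  case False
  define diff :: "nat \<Rightarrow> real \<Rightarrow> real"
    where "diff m u = (\<Prod>i<m. - a - real i) * u powr (- a - real m)" for m u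
  have "\<exists>t. (if 1 + v < 1 then 1 + v < t \<and> t < 1 else 1 < t \<and> t < 1 + v) \<and>
    (1 + v) powr (- a) = (\<Sum>m<3. diff m 1 / fact m * ((1 + v) - 1) ^ m)
      + diff 3 t / fact 3 * ((1 + v) - 1) ^ 3"
  proof (rule Taylor[where a = "1/2" and b = "3/2"])
    show "\<forall>m t. m < 3 \<and> 1 / 2 \<le> t \<and> t \<le> 3 / 2 \<longrightarrow> DERIV (diff m) t :> diff (Suc m) t"
    proof (intro allI impI)
      fix m :: nat and t :: real assume "m < 3 \<and> 1 / 2 \<le> t \<and> t \<le> 3 / 2"
      then have "DERIV (\<lambda>u. u powr (- a - real m)) t :> (- a - real m) * t powr (- a - real m - 1)"
        by (intro has_real_derivative_powr) auto
      from DERIV_cmult[OF this, of "\<Prod>i<m. - a - real i"]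
      show "DERIV (diff m) t :> diff (Suc m) t"
        unfolding diff_def by (simp add: algebra_simps)
    qed
  qed (use v False in \<open>auto simp: diff_def\<close>)
  then obtain t where "if 1 + v < 1 then 1 + v < t \<and> t < 1 else 1 < t \<and> t < 1 + v"
    and eq: "(1 + v) powr (- a) = (\<Sum>m<3. diff m 1 / fact m * v ^ m) + diff 3 t / fact 3 * v ^ 3"
    by auto
  then have t: "t \<ge> 1/2"
    using v by (auto split: if_splits)
  have "(1 + v) powr (- a) - (1 - a * v + a * (a + 1) / 2 * v\<^sup>2)
      = - (a * (a + 1) * (a + 2) / 6 * t powr (- a - 3) * v ^ 3)"
    unfolding eq by (simp add: diff_def eval_nat_numeral algebra_simps)
  then have "\<bar>(1 + v) powr (- a) - (1 - a * v + a * (a + 1) / 2 * v\<^sup>2)\<bar>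
      = a * (a + 1) * (a + 2) / 6 * t powr (- a - 3) * \<bar>v\<bar> ^ 3"
    using a by (simp add: abs_mult power_abs)
  also have "t powr (- a - 3) \<le> (1/2) powr (- a - 3)"
    using t a by (intro powr_mono2') auto
  also have "(1/2 :: real) powr (- a - 3) = 2 powr (a + 3)"
    by (simp add: powr_divide powr_minus_divide powr_diff powr_add powr_minus field_simps)
  finally show ?thesis
    using a by (simp add: mult_left_mono mult_right_mono)
qed simp

text \<open>
  The next two lemmas treat the expansion on the scale where \<open>s + x\<^sup>2 = 1\<close>: \<open>y\<close> stands for
  \<open>x / \<surd>(s + x\<^sup>2)\<close> and \<open>u\<close> for the jump divided by \<open>\<surd>(s + x\<^sup>2)\<close>, so that \<open>s + (x + \<xi>)\<^sup>2\<close> becomes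
  \<open>1 + (2yu + u\<^sup>2)\<close>. Expanding in \<open>v = 2yu + u\<^sup>2\<close> requires only derivatives of a power; the terms of
  \<open>v\<^sup>2\<close> beyond \<open>4y\<^sup>2u\<^sup>2\<close> are of third order in \<open>u\<close> and join the error.
\<close>

lemma unit_expansion_small_jump:
  fixes a y u \<eta> :: real
  assumes a: "a > 0" and y: "0 \<le> y" "y \<le> 1" and u: "\<bar>u\<bar> \<le> \<eta>" and \<eta>: "\<eta> \<le> 1/6"
  shows "\<bar>(1 + (2 * y * u + u\<^sup>2)) powr (- a) - (1 - a * (2 * y * u + u\<^sup>2) + 2 * a * (a + 1) * y\<^sup>2 * u\<^sup>2)\<bar>
    \<le> (5 / 2 * (a * (a + 1)) + 27 * (a * (a + 1) * (a + 2) / 6 * 2 powr (a + 3))) * \<eta> * u\<^sup>2"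
proof -
  define v where "v = 2 * y * u + u\<^sup>2"
  define C where "C = a * (a + 1) * (a + 2) / 6 * 2 powr (a + 3)"
  have C: "C \<ge> 0" using a by (simp add: C_def)
  have "\<bar>u\<bar> \<le> 1" using u \<eta> by simp
  have "\<bar>v\<bar> \<le> 2 * y * \<bar>u\<bar> + \<bar>u\<bar> * \<bar>u\<bar>"
    unfolding v_def using y by (intro order_trans[OF abs_triangle_ineq]) (simp add: abs_mult power2_eq_square)
  also have "\<dots> \<le> 2 * 1 * \<bar>u\<bar> + 1 * \<bar>u\<bar>"
    using y \<open>\<bar>u\<bar> \<le> 1\<close> by (intro add_mono mult_right_mono) auto
  finally have v3: "\<bar>v\<bar> \<le> 3 * \<bar>u\<bar>" by simp
  then have "\<bar>v\<bar> \<le> 1/2" using u \<eta> by simp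
  from powr_minus_taylor2[OF a this]
  have T: "\<bar>(1 + v) powr (- a) - (1 - a * v + a * (a + 1) / 2 * v\<^sup>2)\<bar> \<le> C * \<bar>v\<bar> ^ 3"
    by (simp add: C_def)
  have "\<bar>v\<bar> ^ 3 \<le> (3 * \<bar>u\<bar>) ^ 3" using v3 by (intro power_mono) auto
  from mult_left_mono[OF this C] have v_cube: "C * \<bar>v\<bar> ^ 3 \<le> 27 * C * \<bar>u\<bar> ^ 3"
    by (simp add: power_mult_distrib)
  have D_eq: "a * (a + 1) / 2 * v\<^sup>2 - 2 * a * (a + 1) * y\<^sup>2 * u\<^sup>2 = a * (a + 1) / 2 * (4 * y * u ^ 3 + u ^ 4)"
    by (simp add: v_def power2_eq_square power3_eq_cube power4_eq_xxxx algebra_simps)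
  have D_le: "\<bar>4 * y * u ^ 3 + u ^ 4\<bar> \<le> 5 * \<bar>u\<bar> ^ 3"
  proof -
    have "\<bar>4 * y * u ^ 3 + u ^ 4\<bar> \<le> 4 * y * \<bar>u\<bar> ^ 3 + \<bar>u\<bar> * \<bar>u\<bar> ^ 3"
      using y by (intro order_trans[OF abs_triangle_ineq]) (simp add: abs_mult power_abs eval_nat_numeral)
    also have "\<dots> \<le> 4 * 1 * \<bar>u\<bar> ^ 3 + 1 * \<bar>u\<bar> ^ 3"
      using y \<open>\<bar>u\<bar> \<le> 1\<close> by (intro add_mono mult_right_mono) auto
    finally show ?thesis by simp
  qed
  have D: "\<bar>a * (a + 1) / 2 * v\<^sup>2 - 2 * a * (a + 1) * y\<^sup>2 * u\<^sup>2\<bar> \<le> 5 / 2 * (a * (a + 1)) * \<bar>u\<bar> ^ 3"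
    using a mult_left_mono[OF D_le, of "a * (a + 1) / 2"] unfolding D_eq by (simp add: abs_mult)
  have "\<bar>(1 + v) powr (- a) - (1 - a * v + 2 * a * (a + 1) * y\<^sup>2 * u\<^sup>2)\<bar>
      \<le> (5 / 2 * (a * (a + 1)) + 27 * C) * \<bar>u\<bar> ^ 3"
    using T D v_cube unfolding distrib_right abs_le_iff by linarith
  also have "\<dots> \<le> (5 / 2 * (a * (a + 1)) + 27 * C) * (\<eta> * u\<^sup>2)"
  proof (rule mult_left_mono)
    show "\<bar>u\<bar> ^ 3 \<le> \<eta> * u\<^sup>2"
      using mult_right_mono[OF u, of "u\<^sup>2"] by (simp add: power3_eq_cube power2_eq_square)
  qed (use a C in auto)
  finally show ?thesis unfolding v_def C_def by (simp add: mult.assoc)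
qed

text \<open>
  If \<open>\<bar>u\<bar> > \<eta>\<close>, every bounded quantity is at most a multiple of \<open>u\<^sup>2\<close>, so no cancellation is needed. The only
  quantity without an absolute bound is the power itself, when \<open>1 - y\<^sup>2\<close> is small and the jump leads back
  near the origin; this is the last term.
\<close>

lemma unit_expansion_large_jump:
  fixes a y u \<eta> \<gamma> :: real
  assumes a: "a > 0" and y: "0 \<le> y" "y\<^sup>2 < 1" and yu: "0 \<le> y + u"
    and u: "\<bar>u\<bar> > \<eta>" and \<eta>: "\<eta> > 0" and \<gamma>: "0 < \<gamma>" "\<gamma> < 1"
  shows "\<bar>(1 + (2 * y * u + u\<^sup>2)) powr (- a) - (1 - a * (2 * y * u + u\<^sup>2) + 2 * a * (a + 1) * y\<^sup>2 * u\<^sup>2)\<bar>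
    \<le> ((1 + 2 powr a + (1 - \<gamma>) powr (- 2 * a)) / \<eta>\<^sup>2 + 2 * a / \<eta> + a + 2 * a * (a + 1)) * u\<^sup>2
        + (1 - y\<^sup>2) powr (- a) * of_bool (y\<^sup>2 > 1/2 \<and> u \<le> - \<gamma> * y)"
proof -
  define W where "W = (1 + (2 * y * u + u\<^sup>2)) powr (- a)"
  define G where "G = 2 powr a + (1 - \<gamma>) powr (- 2 * a)"
  have G: "G \<ge> 0" by (simp add: G_def)
  have y1: "y \<le> 1" using y abs_square_less_1[of y] by simp
  have W_eq: "1 + (2 * y * u + u\<^sup>2) = (1 - y\<^sup>2) + (y + u)\<^sup>2"
    by (simp add: power2_eq_square algebra_simps)
  have u2: "1 \<le> u\<^sup>2 / \<eta>\<^sup>2" and u1: "\<bar>u\<bar> \<le> u\<^sup>2 / \<eta>"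
    using u \<eta> power_mono[of \<eta> "\<bar>u\<bar>" 2] mult_right_mono[of \<eta> "\<bar>u\<bar>" "\<bar>u\<bar>"]
    by (auto simp: field_simps power2_eq_square)
  have W: "W \<le> G + (1 - y\<^sup>2) powr (- a) * of_bool (y\<^sup>2 > 1/2 \<and> u \<le> - \<gamma> * y)"
  proof -
    \<comment> \<open>The base of the power is bounded below by \<open>1 - y\<^sup>2\<close> or, if the jump keeps the fraction \<open>1 - \<gamma>\<close>
      of \<open>y\<close>, by \<open>(1 - \<gamma>)\<^sup>2\<close>; the remaining case is the one of the last error term.\<close>
    consider "y\<^sup>2 \<le> 1/2" | "u > - \<gamma> * y" | "y\<^sup>2 > 1/2" "u \<le> - \<gamma> * y" by linarith
    then show ?thesis
    proof cases
      case 1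
      have "1/2 + 0 \<le> (1 - y\<^sup>2) + (y + u)\<^sup>2"
        using 1 by (intro add_mono) auto
      then have "W \<le> (1/2) powr (- a)"
        unfolding W_def W_eq using a by (intro powr_mono2') auto
      also have "\<dots> = 2 powr a" by (simp add: powr_divide powr_minus field_simps)
      finally show ?thesis by (simp add: G_def add_increasing2)
    next
      case 2
      have "((1 - \<gamma>) * y)\<^sup>2 \<le> (y + u)\<^sup>2"
        using 2 y y1 \<gamma> by (intro power_mono mult_nonneg_nonneg) (auto simp: algebra_simps)
      moreover have "(1 - \<gamma>)\<^sup>2 * (1 - y\<^sup>2) \<le> 1 * (1 - y\<^sup>2)"
        using y \<gamma> by (intro mult_right_mono power_le_one) auto
      ultimately have "(1 - \<gamma>)\<^sup>2 \<le> (1 - y\<^sup>2) + (y + u)\<^sup>2"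
        unfolding power_mult_distrib right_diff_distrib by linarith
      then have "W \<le> ((1 - \<gamma>)\<^sup>2) powr (- a)"
        unfolding W_def W_eq using a \<gamma> by (intro powr_mono2') auto
      also have "\<dots> = (1 - \<gamma>) powr (- 2 * a)"
        using \<gamma> by (simp add: powr_powr flip: powr_numeral)
      finally show ?thesis by (simp add: G_def add_increasing add_increasing2)
    next
      case 3
      have "W \<le> (1 - y\<^sup>2) powr (- a)"
        unfolding W_def W_eq using y a by (intro powr_mono2') auto
      then show ?thesis using 3 G by simp
    qed
  qed
  have lin: "\<bar>2 * y * u + u\<^sup>2\<bar> \<le> 2 * (u\<^sup>2 / \<eta>) + u\<^sup>2"
  proof -
    have "\<bar>2 * y * u + u\<^sup>2\<bar> \<le> 2 * (y * \<bar>u\<bar>) + u\<^sup>2"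
      using y by (intro order_trans[OF abs_triangle_ineq]) (simp add: abs_mult)
    moreover have "y * \<bar>u\<bar> \<le> 1 * (u\<^sup>2 / \<eta>)"
      using y y1 u1 \<eta> by (intro mult_mono) auto
    ultimately show ?thesis by simp
  qed
  have quad: "y\<^sup>2 * u\<^sup>2 \<le> 1 * u\<^sup>2" using y by (intro mult_right_mono) auto
  have "\<bar>W - (1 - a * (2 * y * u + u\<^sup>2) + 2 * a * (a + 1) * y\<^sup>2 * u\<^sup>2)\<bar>
      \<le> W + 1 + a * \<bar>2 * y * u + u\<^sup>2\<bar> + 2 * a * (a + 1) * (y\<^sup>2 * u\<^sup>2)"
  proof -
    have tri: "\<bar>w - (1 - p + r)\<bar> \<le> w + 1 + \<bar>p\<bar> + r" if "w \<ge> 0" "r \<ge> 0" for w p r :: real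
      using that by linarith
    show ?thesis
      using tri[of W "2 * a * (a + 1) * y\<^sup>2 * u\<^sup>2" "a * (2 * y * u + u\<^sup>2)"] a
      by (simp add: W_def abs_mult mult.assoc)
  qed
  also have "\<dots> \<le> W + u\<^sup>2 / \<eta>\<^sup>2 + a * (2 * (u\<^sup>2 / \<eta>) + u\<^sup>2) + 2 * a * (a + 1) * (1 * u\<^sup>2)"
    using lin quad u2 a by (intro add_mono mult_left_mono) auto
  also have "W \<le> G * (u\<^sup>2 / \<eta>\<^sup>2) + (1 - y\<^sup>2) powr (- a) * of_bool (y\<^sup>2 > 1/2 \<and> u \<le> - \<gamma> * y)"
    using W mult_left_mono[OF u2 G] by simp
  finally show ?thesis
    unfolding W_def G_def by (simp add: algebra_simps add_divide_distrib)
qed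

definition lyap :: "real \<Rightarrow> real \<Rightarrow> real \<Rightarrow> real" where
  "lyap a s x = (s + x\<^sup>2) powr (- a)"

text \<open>
  The second-order Taylor polynomial of \<open>lyap a s\<close> in \<open>D = 2x\<xi> + \<xi>\<^sup>2\<close>, the increment of \<open>x\<^sup>2\<close>, with \<open>D\<^sup>2\<close>
  replaced by its leading part \<open>4x\<^sup>2\<xi>\<^sup>2\<close>: it involves only the first two moments of the jump.
\<close>

definition lyap_quad :: "real \<Rightarrow> real \<Rightarrow> real \<Rightarrow> real \<Rightarrow> real" where
  "lyap_quad a s x \<xi> = lyap a s x *
     (1 - a * (2 * x * \<xi> + \<xi>\<^sup>2) / (s + x\<^sup>2) + 2 * a * (a + 1) * x\<^sup>2 * \<xi>\<^sup>2 / (s + x\<^sup>2)\<^sup>2)"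

text \<open>
  The order of the quantifiers matters: \<open>C1\<close> does not depend on the threshold \<open>\<eta>\<close>, so the first error term can
  be made small by the choice of \<open>\<eta>\<close>, after which the truncated second moment next to \<open>C2\<close> tends to 0 as
  \<open>s \<rightarrow> \<infinity>\<close>.
\<close>

lemma lyap_expansion:
  fixes a \<gamma> :: real
  assumes a: "a > 0" and \<gamma>: "0 < \<gamma>" "\<gamma> < 1"
  obtains C1 where "C1 \<ge> 0"
    "\<And>\<eta>. 0 < \<eta> \<Longrightarrow> \<eta> \<le> 1/6 \<Longrightarrow> \<exists>C2\<ge>0. \<forall>s>0. \<forall>x\<ge>0. \<forall>z\<ge>0.
       \<bar>lyap a s z - lyap_quad a s x (z - x)\<bar>
         \<le> lyap a s x / (s + x\<^sup>2) * (C1 * \<eta> * (z - x)\<^sup>2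
             + C2 * ((z - x)\<^sup>2 * indicator {z. (z - x)\<^sup>2 > \<eta>\<^sup>2 * s} z))
           + s powr (- a) * of_bool (x\<^sup>2 > s \<and> z - x \<le> - \<gamma> * x)"
proof
  define C1 where "C1 = 5 / 2 * (a * (a + 1)) + 27 * (a * (a + 1) * (a + 2) / 6 * 2 powr (a + 3))"
  show C1: "C1 \<ge> 0" using a by (simp add: C1_def)
  fix \<eta> :: real assume \<eta>: "0 < \<eta>" "\<eta> \<le> 1/6"
  define C2 where "C2 = (1 + 2 powr a + (1 - \<gamma>) powr (- 2 * a)) / \<eta>\<^sup>2 + 2 * a / \<eta> + a + 2 * a * (a + 1)"
  have C2: "C2 \<ge> 0" using a \<eta> by (simp add: C2_def)
  show "\<exists>C2\<ge>0. \<forall>s>0. \<forall>x\<ge>0. \<forall>z\<ge>0.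
       \<bar>lyap a s z - lyap_quad a s x (z - x)\<bar>
         \<le> lyap a s x / (s + x\<^sup>2) * (C1 * \<eta> * (z - x)\<^sup>2
             + C2 * ((z - x)\<^sup>2 * indicator {z. (z - x)\<^sup>2 > \<eta>\<^sup>2 * s} z))
           + s powr (- a) * of_bool (x\<^sup>2 > s \<and> z - x \<le> - \<gamma> * x)"
  proof (intro exI[of _ C2] conjI C2 allI impI)
    fix s x z :: real assume s: "s > 0" and x: "x \<ge> 0" and z: "z \<ge> 0"
    define t where "t = s + x\<^sup>2"
    have t: "t > 0" using s by (simp add: t_def add_pos_nonneg)
    define r where "r = sqrt t"
    have r: "r > 0" "r\<^sup>2 = t" using t by (auto simp: r_def)
    define y u where "y = x / r" and "u = (z - x) / r"
    have y2: "y\<^sup>2 = x\<^sup>2 / t" and u2: "u\<^sup>2 = (z - x)\<^sup>2 / t" and yu: "y * u = x * (z - x) / t"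
      using r by (simp_all add: y_def u_def power_divide power2_eq_square)
    have y: "0 \<le> y" "y\<^sup>2 < 1" "0 \<le> y + u"
      using x r s z t by (auto simp: y2[unfolded y_def] t_def y_def u_def simp flip: add_divide_distrib)
    then have y1: "y \<le> 1" using abs_square_less_1[of y] by simp
    have one: "1 - y\<^sup>2 = s / t" using t by (simp add: y2 t_def field_simps)
    let ?E = "\<bar>(1 + (2 * y * u + u\<^sup>2)) powr (- a) - (1 - a * (2 * y * u + u\<^sup>2) + 2 * a * (a + 1) * y\<^sup>2 * u\<^sup>2)\<bar>"
    have E: "?E \<le> (C1 * \<eta> + C2 * of_bool (\<bar>u\<bar> > \<eta>)) * u\<^sup>2
        + (s / t) powr (- a) * of_bool (y\<^sup>2 > 1/2 \<and> u \<le> - \<gamma> * y)"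
    proof (cases "\<bar>u\<bar> > \<eta>")
      case True
      have "?E \<le> C2 * u\<^sup>2 + (s / t) powr (- a) * of_bool (y\<^sup>2 > 1/2 \<and> u \<le> - \<gamma> * y)"
        using unit_expansion_large_jump[OF a y True \<eta>(1) \<gamma>] unfolding one C2_def by simp
      moreover have "0 \<le> C1 * \<eta> * u\<^sup>2" using C1 \<eta> by simp
      ultimately show ?thesis using True by (simp add: distrib_right)
    next
      case False
      have "?E \<le> C1 * \<eta> * u\<^sup>2"
        using unit_expansion_small_jump[OF a y(1) y1 _ \<eta>(2)] False unfolding C1_def by simp
      then show ?thesis using False by (auto intro: add_increasing2)
    qed
    have Fz: "lyap a s z = lyap a s x * (1 + (2 * y * u + u\<^sup>2)) powr (- a)"
    proof -
      have "s + z\<^sup>2 = t * (1 + (2 * y * u + u\<^sup>2))"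
      proof -
        have "t * (1 + (2 * y * u + u\<^sup>2)) = t + 2 * (x * (z - x)) + (z - x)\<^sup>2"
          using t unfolding mult.assoc yu u2 by (simp add: field_simps)
        then show ?thesis by (simp add: t_def power2_eq_square algebra_simps)
      qed
      then show ?thesis
        using t y by (simp add: lyap_def powr_mult flip: t_def)
    qed
    have Q: "lyap_quad a s x (z - x)
      = lyap a s x * (1 - a * (2 * y * u + u\<^sup>2) + 2 * a * (a + 1) * y\<^sup>2 * u\<^sup>2)"
      unfolding lyap_quad_def mult.assoc yu u2 y2 t_def[symmetric]
      by (simp add: power2_eq_square add_divide_distrib distrib_left)
    have Fx: "lyap a s x = t powr (- a)" by (simp add: lyap_def t_def)
    have "\<bar>lyap a s z - lyap_quad a s x (z - x)\<bar> = t powr (- a) * ?E"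
      unfolding Fz Q Fx by (simp add: abs_mult flip: right_diff_distrib)
    also have "\<dots> \<le> t powr (- a) * ((C1 * \<eta> + C2 * of_bool (\<bar>u\<bar> > \<eta>)) * u\<^sup>2
        + (s / t) powr (- a) * of_bool (y\<^sup>2 > 1/2 \<and> u \<le> - \<gamma> * y))"
      using E by (intro mult_left_mono) auto
    also have "\<dots> = t powr (- a) / t * (C1 * \<eta> * (z - x)\<^sup>2 + C2 * ((z - x)\<^sup>2 * of_bool (\<bar>u\<bar> > \<eta>)))
        + s powr (- a) * of_bool (y\<^sup>2 > 1/2 \<and> u \<le> - \<gamma> * y)"
      using s t by (simp add: u2 powr_divide powr_minus field_simps)
    also have "\<dots> \<le> t powr (- a) / t * (C1 * \<eta> * (z - x)\<^sup>2
         + C2 * ((z - x)\<^sup>2 * indicator {z. (z - x)\<^sup>2 > \<eta>\<^sup>2 * s} z))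
        + s powr (- a) * of_bool (x\<^sup>2 > s \<and> z - x \<le> - \<gamma> * x)"
    proof (intro add_mono mult_left_mono order_refl)
      show "of_bool (\<bar>u\<bar> > \<eta>) \<le> (indicator {z. (z - x)\<^sup>2 > \<eta>\<^sup>2 * s} z :: real)"
      proof (cases "\<bar>u\<bar> > \<eta>")
        case True
        then have "\<eta>\<^sup>2 < u\<^sup>2" using \<eta> power_strict_mono[of \<eta> "\<bar>u\<bar>" 2] by simp
        then have "\<eta>\<^sup>2 * t < (z - x)\<^sup>2" using t by (simp add: u2 field_simps)
        moreover have "\<eta>\<^sup>2 * s \<le> \<eta>\<^sup>2 * t" by (intro mult_left_mono) (auto simp: t_def)
        ultimately show ?thesis by simp
      qed simp
      show "of_bool (y\<^sup>2 > 1/2 \<and> u \<le> - \<gamma> * y) \<le> (of_bool (x\<^sup>2 > s \<and> z - x \<le> - \<gamma> * x) :: real)"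
        using t divide_le_cancel[of "z - x" r "- \<gamma> * x"] r by (auto simp: y2 u_def y_def t_def field_simps)
    qed (use t C1 C2 \<eta> in auto)
    finally show "\<bar>lyap a s z - lyap_quad a s x (z - x)\<bar>
         \<le> lyap a s x / (s + x\<^sup>2) * (C1 * \<eta> * (z - x)\<^sup>2
             + C2 * ((z - x)\<^sup>2 * indicator {z. (z - x)\<^sup>2 > \<eta>\<^sup>2 * s} z))
           + s powr (- a) * of_bool (x\<^sup>2 > s \<and> z - x \<le> - \<gamma> * x)"
      by (simp add: Fx flip: t_def)
  qed
qed

section \<open>Green measure of a chain on the half-line\<close>

locale half_line_chain =
  fixes M :: "'a measure" and K :: "real \<Rightarrow> real measure" and X :: "nat \<Rightarrow> 'a \<Rightarrow> real"
  assumes chain: "markov_chain M K X"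
begin

sublocale prob_space M
  using chain by (simp add: markov_chain_def)

lemma space_Rplus [simp]: "space Rplus = {0..}"
  by (simp add: space_restrict_space)

lemma K_prob_algebra: "K \<in> Rplus \<rightarrow>\<^sub>M prob_algebra Rplus"
  using chain by (simp add: markov_chain_def)

lemma K_subprob_algebra [measurable]: "K \<in> Rplus \<rightarrow>\<^sub>M subprob_algebra Rplus"
  using K_prob_algebra by (rule measurable_prob_algebraD)

lemma X_measurable [measurable]: "X n \<in> M \<rightarrow>\<^sub>M Rplus"
  using chain by (simp add: markov_chain_def)

lemma X_borel_measurable [measurable]: "X n \<in> borel_measurable M"
  using X_measurable[of n] by (simp add: measurable_restrict_space2_iff)

lemma X_nonneg: "\<omega> \<in> space M \<Longrightarrow> 0 \<le> X n \<omega>"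
  using measurable_space[OF X_measurable] by simp

lemma prob_space_K: "x \<ge> 0 \<Longrightarrow> prob_space (K x)"
  and sets_K: "x \<ge> 0 \<Longrightarrow> sets (K x) = sets Rplus"
  using measurable_space[OF K_prob_algebra, of x] by (simp_all add: space_prob_algebra)

lemma space_K: "x \<ge> 0 \<Longrightarrow> space (K x) = {0..}"
  using sets_eq_imp_space_eq[OF sets_K] by simp

lemma measurable_K: "x \<ge> 0 \<Longrightarrow> borel_measurable (K x) = borel_measurable Rplus"
  by (intro measurable_cong_sets sets_K refl)

lemma borel_measurable_Rplus:
  "h \<in> borel_measurable borel \<Longrightarrow> h \<in> borel_measurable Rplus"
  by (rule measurable_restrict_space1)

definition transition :: "(real \<Rightarrow> ennreal) \<Rightarrow> real \<Rightarrow> ennreal" where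
  "transition h x = (\<integral>\<^sup>+z. h z \<partial>K x)"

lemma transition_measurable [measurable]:
  "h \<in> borel_measurable Rplus \<Longrightarrow> transition h \<in> borel_measurable Rplus"
  unfolding transition_def
  by (rule measurable_compose[OF K_subprob_algebra nn_integral_measurable_subprob_algebra])

lemma transition_iterate_measurable [measurable]:
  "h \<in> borel_measurable Rplus \<Longrightarrow> (transition ^^ n) h \<in> borel_measurable Rplus"
  by (induction n) auto

lemma nn_integral_X_Suc:
  assumes [measurable]: "h \<in> borel_measurable Rplus"
  shows "(\<integral>\<^sup>+\<omega>. h (X (Suc n) \<omega>) \<partial>M) = (\<integral>\<^sup>+\<omega>. transition h (X n \<omega>) \<partial>M)"
proof -
  have "(\<integral>\<^sup>+\<omega>. h (X (Suc n) \<omega>) \<partial>M) = (\<integral>\<^sup>+x. h x \<partial>distr M Rplus (X (Suc n)))"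
    by (subst nn_integral_distr) auto
  also have "\<dots> = (\<integral>\<^sup>+x. transition h x \<partial>distr M Rplus (X n))"
    unfolding markov_chain_distr_Suc[OF chain] transition_def
    by (subst nn_integral_bind[where B = Rplus]) auto
  also have "\<dots> = (\<integral>\<^sup>+\<omega>. transition h (X n \<omega>) \<partial>M)"
    by (subst nn_integral_distr) auto
  finally show ?thesis .
qed

lemma nn_integral_X_iterate:
  assumes "h \<in> borel_measurable Rplus"
  shows "(\<integral>\<^sup>+\<omega>. h (X n \<omega>) \<partial>M) = (\<integral>\<^sup>+\<omega>. (transition ^^ n) h (X 0 \<omega>) \<partial>M)"
  using assms by (induction n arbitrary: h) (simp_all add: nn_integral_X_Suc funpow_swap1)

lemma sets_law_from: "y \<ge> 0 \<Longrightarrow> sets (law_from K n y) = sets Rplus"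
proof (induction n)
  case (Suc n)
  have "space (law_from K n y) = {0..}"
    using sets_eq_imp_space_eq[OF Suc.IH[OF Suc.prems]] by simp
  then show ?case
    unfolding law_from.simps using sets_K by (intro sets_bind) auto
qed simp

lemma nn_integral_law_from:
  assumes "y \<ge> 0" "h \<in> borel_measurable Rplus"
  shows "(\<integral>\<^sup>+z. h z \<partial>law_from K n y) = (transition ^^ n) h y"
  using assms(2)
proof (induction n arbitrary: h)
  case 0
  then show ?case using assms(1) by (simp add: nn_integral_return)
next
  case (Suc n)
  have "K \<in> law_from K n y \<rightarrow>\<^sub>M subprob_algebra Rplus"
    using K_subprob_algebra sets_law_from[OF assms(1)] by (simp cong: measurable_cong_sets)
  with Suc.prems have "(\<integral>\<^sup>+z. h z \<partial>law_from K (Suc n) y) = (\<integral>\<^sup>+x. transition h x \<partial>law_from K n y)"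
    unfolding transition_def by (simp add: nn_integral_bind[where B = Rplus])
  with Suc show ?case by (simp add: funpow_swap1)
qed

text \<open>
  A maximum principle replaces the strong Markov property at the first visit to \<open>[0, x\<^sub>0]\<close>. The expected
  number \<open>G\<^sub>N\<close> of visits before time \<open>N\<close> satisfies \<open>G\<^bsub>N+1\<^esub> = 1\<^sub>B + K G\<^sub>N\<close>; on \<open>B\<close> it is at most \<open>c\<close> by
  assumption, and off \<open>B\<close> it is an average of values of \<open>G\<^sub>N\<close>, so the bound propagates by induction.
\<close>

lemma occupation_le:
  assumes c: "\<And>y. y \<in> {0..x0} \<Longrightarrow> (\<Sum>n. emeasure (law_from K n y) {0..x0}) \<le> c"
  shows "(\<Sum>n. emeasure M {\<omega> \<in> space M. X n \<omega> \<le> x0}) \<le> c"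
proof -
  define B where "B = {0..x0}"
  have B[measurable]: "B \<in> sets Rplus"
    by (auto simp: B_def sets_restrict_space_iff)
  have iterate: "(transition ^^ n) (indicator B) y = emeasure (law_from K n y) B" if "y \<ge> 0" for n y
    using that B by (simp add: sets_law_from flip: nn_integral_law_from)
  define G where "G N y = (\<Sum>n<N. (transition ^^ n) (indicator B) y)" for N y
  have G_Suc: "G (Suc N) y = indicator B y + transition (G N) y" if "y \<ge> 0" for N y
  proof -
    have "transition (G N) y = (\<Sum>n<N. (transition ^^ Suc n) (indicator B) y)"
      unfolding G_def transition_def[of "\<lambda>y. \<Sum>n<N. (transition ^^ n) (indicator B) y"]
      by (subst nn_integral_sum) (auto simp: measurable_K[OF that] transition_def)
    then show ?thesis
      unfolding G_def by (simp add: sum.lessThan_Suc_shift del: sum.lessThan_Suc)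
  qed
  have G_le: "G N y \<le> c" if "y \<ge> 0" for N y
    using that
  proof (induction N arbitrary: y)
    case (Suc N)
    show ?case
    proof (cases "y \<in> B")
      case True
      have "G (Suc N) y = (\<Sum>n<Suc N. emeasure (law_from K n y) B)"
        unfolding G_def using Suc.prems by (intro sum.cong iterate) auto
      also have "\<dots> \<le> (\<Sum>n. emeasure (law_from K n y) B)"
        by (intro sum_le_suminf) auto
      also have "\<dots> \<le> c" using c True by (simp add: B_def)
      finally show ?thesis .
    next
      case False
      interpret Ky: prob_space "K y" using prob_space_K Suc.prems .
      have "G (Suc N) y = (\<integral>\<^sup>+z. G N z \<partial>K y)"
        using False by (simp add: G_Suc Suc.prems transition_def)
      also have "\<dots> \<le> (\<integral>\<^sup>+z. c \<partial>K y)"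
        by (intro nn_integral_mono Suc.IH) (simp add: space_K Suc.prems)
      finally show ?thesis by (simp add: Ky.emeasure_space_1)
    qed
  qed (simp add: G_def)
  have "(\<Sum>n<N. emeasure M {\<omega> \<in> space M. X n \<omega> \<le> x0}) \<le> c" for N
  proof -
    have "(\<Sum>n<N. emeasure M {\<omega> \<in> space M. X n \<omega> \<le> x0}) = (\<Sum>n<N. \<integral>\<^sup>+\<omega>. indicator B (X n \<omega>) \<partial>M)"
    proof (intro sum.cong refl)
      fix n
      have "(\<integral>\<^sup>+\<omega>. indicator B (X n \<omega>) \<partial>M) = (\<integral>\<^sup>+\<omega>. indicator {\<omega> \<in> space M. X n \<omega> \<le> x0} \<omega> \<partial>M)"
        by (intro nn_integral_cong) (auto simp: B_def indicator_def X_nonneg)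
      also have "\<dots> = emeasure M {\<omega> \<in> space M. X n \<omega> \<le> x0}"
        by (intro nn_integral_indicator) measurable
      finally show "emeasure M {\<omega> \<in> space M. X n \<omega> \<le> x0} = (\<integral>\<^sup>+\<omega>. indicator B (X n \<omega>) \<partial>M)" ..
    qed
    also have "\<dots> = (\<integral>\<^sup>+\<omega>. G N (X 0 \<omega>) \<partial>M)"
      unfolding G_def by (subst nn_integral_sum) (auto intro!: sum.cong nn_integral_X_iterate)
    also have "\<dots> \<le> (\<integral>\<^sup>+\<omega>. c \<partial>M)"
      by (intro nn_integral_mono G_le X_nonneg)
    finally show ?thesis by (simp add: emeasure_space_1)
  qed
  then show ?thesis by (rule suminf_le_const[OF summableI])
qed

text \<open>
  Realizing \<open>\<Sum>\<^sub>n P(X\<^sub>n \<in> B)\<close> as an image of the product with the counting measure makes the theorems on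
  product measures available for exchanging the sum over time with integrals.
\<close>

definition green :: "real measure" where
  "green = distr (count_space UNIV \<Otimes>\<^sub>M M) Rplus (\<lambda>(n, \<omega>). X n \<omega>)"

lemma joint_measurable [measurable]:
  "(\<lambda>(n, \<omega>). X n \<omega>) \<in> count_space UNIV \<Otimes>\<^sub>M M \<rightarrow>\<^sub>M Rplus"
  by (rule measurable_pair_measure_countable1) auto

lemma sets_green [measurable_cong, simp]: "sets green = sets Rplus"
  by (simp add: green_def)

lemma space_green [simp]: "space green = {0..}"
  by (simp add: green_def)

lemma nn_integral_green:
  assumes [measurable]: "h \<in> borel_measurable Rplus"
  shows "(\<integral>\<^sup>+x. h x \<partial>green) = (\<Sum>n. \<integral>\<^sup>+\<omega>. h (X n \<omega>) \<partial>M)"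
proof -
  have "(\<integral>\<^sup>+x. h x \<partial>green) = (\<integral>\<^sup>+p. h (case p of (n, \<omega>) \<Rightarrow> X n \<omega>) \<partial>(count_space UNIV \<Otimes>\<^sub>M M))"
    unfolding green_def by (rule nn_integral_distr) auto
  also have "\<dots> = (\<integral>\<^sup>+n. \<integral>\<^sup>+\<omega>. h (X n \<omega>) \<partial>M \<partial>count_space UNIV)"
    by (subst nn_integral_fst[symmetric]) auto
  finally show ?thesis by (simp add: nn_integral_count_space_nat)
qed

lemma emeasure_green_Icc:
  "emeasure green {0..A} = (\<Sum>n. emeasure M {\<omega> \<in> space M. X n \<omega> \<le> A})"
proof -
  have A: "{0..A} \<in> sets Rplus"
    by (auto simp: sets_restrict_space_iff)
  then have "emeasure green {0..A} = (\<integral>\<^sup>+x. indicator {0..A} x \<partial>green)"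
    by (intro nn_integral_indicator[symmetric]) simp
  also have "\<dots> = (\<Sum>n. \<integral>\<^sup>+\<omega>. indicator {0..A} (X n \<omega>) \<partial>M)"
    by (intro nn_integral_green borel_measurable_indicator A)
  also have "\<dots> = (\<Sum>n. emeasure M {\<omega> \<in> space M. X n \<omega> \<le> A})"
  proof (intro suminf_cong)
    fix n
    have "(\<integral>\<^sup>+\<omega>. indicator {0..A} (X n \<omega>) \<partial>M) = (\<integral>\<^sup>+\<omega>. indicator {\<omega> \<in> space M. X n \<omega> \<le> A} \<omega> \<partial>M)"
      by (intro nn_integral_cong) (auto simp: indicator_def X_nonneg)
    also have "\<dots> = emeasure M {\<omega> \<in> space M. X n \<omega> \<le> A}"
      by (intro nn_integral_indicator) measurable
    finally show "(\<integral>\<^sup>+\<omega>. indicator {0..A} (X n \<omega>) \<partial>M) = emeasure M {\<omega> \<in> space M. X n \<omega> \<le> A}" .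
  qed
  finally show ?thesis .
qed

lemma integral_green_sums:
  fixes h :: "real \<Rightarrow> real"
  assumes "integrable green h"
  shows "(\<lambda>n. \<integral>\<omega>. h (X n \<omega>) \<partial>M) sums (\<integral>x. h x \<partial>green)"
proof -
  interpret sigma_finite_measure "count_space (UNIV :: nat set)"
    by (rule sigma_finite_measure_count_space)
  interpret pair_sigma_finite "count_space (UNIV :: nat set)" M ..
  have h: "h \<in> borel_measurable Rplus"
    using assms by (auto dest: borel_measurable_integrable)
  let ?f = "\<lambda>p. h (case p of (n, \<omega>) \<Rightarrow> X n \<omega>)"
  have int: "integrable (count_space UNIV \<Otimes>\<^sub>M M) ?f"
    using assms h unfolding green_def by (subst (asm) integrable_distr_eq) auto
  have "(\<integral>x. h x \<partial>green) = (\<integral>p. ?f p \<partial>(count_space UNIV \<Otimes>\<^sub>M M))"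
    unfolding green_def using h by (subst integral_distr) auto
  also have "\<dots> = (\<integral>n. \<integral>\<omega>. h (X n \<omega>) \<partial>M \<partial>count_space UNIV)"
    using integral_fst'[OF int] by simp
  finally show ?thesis
    using sums_integral_count_space_nat[OF integrable_fst'[OF int]] by simp
qed

text \<open>
  The Foster--Lyapunov argument: where \<open>h\<close> decreases on average by \<open>V\<close>, the total expected decrease is at
  most the initial value plus what is gained on \<open>B\<close>. Working in the extended nonnegative reals, it needs no
  integrability, and hence also proves that \<open>V\<close> is integrable.
\<close>

lemma foster_bound:
  fixes h V :: "real \<Rightarrow> ennreal"
  assumes [measurable]: "h \<in> borel_measurable Rplus" "V \<in> borel_measurable Rplus" "B \<in> sets Rplus"
    and drift: "\<And>x. x \<ge> 0 \<Longrightarrow> transition h x + V x \<le> h x + D * indicator B x"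
  shows "(\<integral>\<^sup>+x. V x \<partial>green) \<le> (\<integral>\<^sup>+\<omega>. h (X 0 \<omega>) \<partial>M) + D * (\<integral>\<^sup>+x. indicator B x \<partial>green)"
proof -
  let ?E = "\<lambda>f n. \<integral>\<^sup>+\<omega>. f (X n \<omega>) \<partial>M"
  have step: "?E h (Suc n) + ?E V n \<le> ?E h n + D * ?E (indicator B) n" for n
  proof -
    have "?E h (Suc n) + ?E V n = (\<integral>\<^sup>+\<omega>. transition h (X n \<omega>) + V (X n \<omega>) \<partial>M)"
      by (simp add: nn_integral_X_Suc nn_integral_add)
    also have "\<dots> \<le> (\<integral>\<^sup>+\<omega>. h (X n \<omega>) + D * indicator B (X n \<omega>) \<partial>M)"
      by (intro nn_integral_mono drift X_nonneg)
    finally show ?thesis by (simp add: nn_integral_add nn_integral_cmult)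
  qed
  have partial: "?E h n + (\<Sum>i<n. ?E V i) \<le> ?E h 0 + D * (\<Sum>i<n. ?E (indicator B) i)" for n
  proof (induction n)
    case (Suc n)
    have "?E h (Suc n) + (\<Sum>i<Suc n. ?E V i) = (?E h (Suc n) + ?E V n) + (\<Sum>i<n. ?E V i)"
      by (simp add: ac_simps)
    also have "\<dots> \<le> (?E h n + D * ?E (indicator B) n) + (\<Sum>i<n. ?E V i)"
      by (intro add_right_mono step)
    also have "\<dots> = (?E h n + (\<Sum>i<n. ?E V i)) + D * ?E (indicator B) n"
      by (simp add: ac_simps)
    also have "\<dots> \<le> (?E h 0 + D * (\<Sum>i<n. ?E (indicator B) i)) + D * ?E (indicator B) n"
      by (intro add_right_mono Suc.IH)
    finally show ?case by (simp add: algebra_simps)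
  qed simp
  have "(\<Sum>n. ?E V n) \<le> ?E h 0 + D * (\<Sum>n. ?E (indicator B) n)"
  proof (rule suminf_le_const[OF summableI])
    fix n
    have "(\<Sum>i<n. ?E V i) \<le> ?E h n + (\<Sum>i<n. ?E V i)"
      by (simp add: add_increasing)
    also note partial[of n]
    also have "?E h 0 + D * (\<Sum>i<n. ?E (indicator B) i) \<le> ?E h 0 + D * (\<Sum>n. ?E (indicator B) n)"
      by (intro add_left_mono mult_left_mono sum_le_suminf) auto
    finally show "(\<Sum>i<n. ?E V i) \<le> ?E h 0 + D * (\<Sum>n. ?E (indicator B) n)" .
  qed
  then show ?thesis by (simp add: nn_integral_green del: nn_integral_indicator)
qed

definition generator :: "(real \<Rightarrow> real) \<Rightarrow> real \<Rightarrow> real" where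
  "generator h x = (\<integral>z. h z \<partial>K x) - h x"

lemma generator_measurable [measurable]:
  assumes [measurable]: "h \<in> borel_measurable Rplus"
  shows "generator h \<in> borel_measurable Rplus"
proof -
  have "(\<lambda>x. \<integral>z. h z \<partial>K x) \<in> borel_measurable Rplus"
    by (rule measurable_compose[OF K_subprob_algebra integral_measurable_subprob_algebra]) fact
  then show ?thesis unfolding generator_def by measurable
qed

lemma integrable_bounded_K:
  fixes h :: "real \<Rightarrow> real"
  assumes "x \<ge> 0" "h \<in> borel_measurable Rplus" "\<And>z. z \<ge> 0 \<Longrightarrow> \<bar>h z\<bar> \<le> B"
  shows "integrable (K x) h"
proof -
  interpret Kx: prob_space "K x" using prob_space_K assms(1) .
  show ?thesis
    using assms by (intro Kx.integrable_const_bound[where B = B])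
      (auto intro!: AE_I2 simp: space_K measurable_K)
qed

text \<open>
  The expectations of the generator along the chain telescope.
\<close>

lemma potential_identity:
  assumes h[measurable]: "h \<in> borel_measurable Rplus"
    and bounded: "\<And>x. x \<ge> 0 \<Longrightarrow> 0 \<le> h x \<and> h x \<le> B"
    and int: "integrable green (generator h)"
    and vanish: "(\<lambda>n. \<integral>\<omega>. h (X n \<omega>) \<partial>M) \<longlonglongrightarrow> 0"
  shows "(\<integral>x. generator h x \<partial>green) = - (\<integral>\<omega>. h (X 0 \<omega>) \<partial>M)"
proof -
  have bK: "0 \<le> (\<integral>z. h z \<partial>K x)" "(\<integral>z. h z \<partial>K x) \<le> B"
    and nnK: "transition (\<lambda>z. ennreal (h z)) x = ennreal (\<integral>z. h z \<partial>K x)" if x: "x \<ge> 0" for x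
  proof -
    interpret Kx: prob_space "K x" using prob_space_K x .
    have i: "integrable (K x) h"
      using bounded by (intro integrable_bounded_K[where B = B] x h) auto
    show "0 \<le> (\<integral>z. h z \<partial>K x)"
      using bounded by (intro integral_nonneg_AE AE_I2) (simp add: space_K x)
    show "(\<integral>z. h z \<partial>K x) \<le> B"
      using bounded by (intro Kx.integral_le_const i AE_I2) (simp add: space_K x)
    show "transition (\<lambda>z. ennreal (h z)) x = ennreal (\<integral>z. h z \<partial>K x)"
      unfolding transition_def using bounded by (intro nn_integral_eq_integral i AE_I2) (auto simp: space_K x)
  qed
  have Km: "(\<lambda>x. \<integral>z. h z \<partial>K x) \<in> borel_measurable Rplus"
    by (rule measurable_compose[OF K_subprob_algebra integral_measurable_subprob_algebra]) fact
  have ih: "integrable M (\<lambda>\<omega>. h (X n \<omega>))" for n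
    using bounded
    by (intro integrable_const_bound[where B = B] AE_I2 measurable_compose[OF X_measurable h])
      (simp add: X_nonneg)
  have iK: "integrable M (\<lambda>\<omega>. \<integral>z. h z \<partial>K (X n \<omega>))" for n
    using bK
    by (intro integrable_const_bound[where B = B] AE_I2 measurable_compose[OF X_measurable Km])
      (simp add: X_nonneg)
  have Suc: "(\<integral>\<omega>. h (X (Suc n) \<omega>) \<partial>M) = (\<integral>\<omega>. \<integral>z. h z \<partial>K (X n \<omega>) \<partial>M)" for n
  proof -
    have "ennreal (\<integral>\<omega>. h (X (Suc n) \<omega>) \<partial>M) = (\<integral>\<^sup>+\<omega>. ennreal (h (X (Suc n) \<omega>)) \<partial>M)"
      using bounded by (intro nn_integral_eq_integral[symmetric] ih AE_I2) (auto simp: X_nonneg)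
    also have "\<dots> = (\<integral>\<^sup>+\<omega>. transition (\<lambda>z. ennreal (h z)) (X n \<omega>) \<partial>M)"
      by (intro nn_integral_X_Suc) auto
    also have "\<dots> = (\<integral>\<^sup>+\<omega>. ennreal (\<integral>z. h z \<partial>K (X n \<omega>)) \<partial>M)"
      by (intro nn_integral_cong nnK X_nonneg)
    also have "\<dots> = ennreal (\<integral>\<omega>. \<integral>z. h z \<partial>K (X n \<omega>) \<partial>M)"
      using bK by (intro nn_integral_eq_integral iK AE_I2) (auto simp: X_nonneg)
    finally show ?thesis
      using bounded bK
      by (subst (asm) ennreal_inj) (simp_all add: Bochner_Integration.integral_nonneg_AE X_nonneg)
  qed
  have "(\<integral>\<omega>. generator h (X n \<omega>) \<partial>M) = (\<integral>\<omega>. h (X (Suc n) \<omega>) \<partial>M) - (\<integral>\<omega>. h (X n \<omega>) \<partial>M)" for n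
    unfolding generator_def Suc using ih iK by (intro Bochner_Integration.integral_diff)
  then have "(\<lambda>n. \<integral>\<omega>. generator h (X n \<omega>) \<partial>M) sums (0 - (\<integral>\<omega>. h (X 0 \<omega>) \<partial>M))"
    using telescope_sums[OF vanish] by simp
  with integral_green_sums[OF int] show ?thesis
    using sums_unique2 by fastforce
qed

end

section \<open>The generator on the test functions\<close>

lemma lyap_nonneg [simp]: "lyap a s x \<ge> 0"
  by (simp add: lyap_def)

lemma lyap_le: "a \<ge> 0 \<Longrightarrow> s > 0 \<Longrightarrow> lyap a s x \<le> s powr (- a)"
  unfolding lyap_def by (intro powr_mono2') auto

lemma lyap_plus_1:
  assumes "s > 0"
  shows "lyap (a + 1) s x = lyap a s x / (s + x\<^sup>2)"
proof -
  have "s + x\<^sup>2 > 0" using assms by (simp add: add_pos_nonneg)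
  then show ?thesis by (simp add: lyap_def powr_diff)
qed

text \<open>
  A larger exponent is worth a power of \<open>s\<close>. Hence the a priori bound for the single exponent \<open>d\<close> serves
  all exponents \<open>a \<ge> d\<close>.
\<close>

lemma lyap_exponent_le:
  assumes "d \<le> a" "s > 0"
  shows "lyap a s x \<le> s powr (d - a) * lyap d s x"
proof -
  have "s + x\<^sup>2 > 0" using assms by (simp add: add_pos_nonneg)
  then have "lyap a s x = (s + x\<^sup>2) powr (d - a) * lyap d s x"
    by (simp add: lyap_def flip: powr_add)
  also have "\<dots> \<le> s powr (d - a) * lyap d s x"
    using assms by (intro mult_right_mono powr_mono2') auto
  finally show ?thesis .
qed

lemma lyap_borel [measurable]: "lyap a s \<in> borel_measurable Rplus"
  unfolding lyap_def by (intro measurable_restrict_space1) measurable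

text \<open>
  Chains whose drift is of order \<open>1/x\<close> are the subject of Lamperti's problem.
\<close>

locale lamperti_chain = half_line_chain M K X
  for M :: "'a measure" and K X +
  fixes N :: "'b measure" and \<Xi> :: "'b \<Rightarrow> real" and \<mu> b \<delta> \<gamma> x0 \<epsilon>0 \<epsilon> :: real
  assumes m1: "jump_moment K 1 \<sim>[at_top] (\<lambda>x. \<mu> / x)"
    and m2: "(jump_moment K 2 \<longlongrightarrow> b) at_top"
    and b_pos: "b > 0"
    and mu_b: "2 * \<mu> > b"
    and \<delta>: "\<delta> > 0"
    and \<gamma>: "0 < \<gamma>" "\<gamma> < 1"
    and left_tail: "(\<lambda>x. measure (jump_law K x) {z. z \<le> - \<gamma> * x})
          \<in> o[at_top](\<lambda>x. jump_moment K 2 x / x powr (2 + \<delta>))"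
    and params: "x0 \<ge> 0" "\<epsilon>0 \<ge> 0" "\<epsilon> > 0"
    and drift: "\<And>x. x \<ge> 0 \<Longrightarrow>
          2 * x * jump_moment K 1 x + jump_moment K 2 x \<ge> (if x > x0 then \<epsilon> else - \<epsilon>0)"
    and occupation: "(SUP y\<in>{0..x0}. \<Sum>n. emeasure (law_from K n y) {0..x0}) < \<infinity>"
    and \<Xi>: "prob_space N" "integrable N \<Xi>"
    and domination: "\<And>x. x \<ge> 0 \<Longrightarrow> st_le (jump_law K x) (\<lambda>z. z\<^sup>2) N \<Xi>"
begin

abbreviation "m\<^sub>1 \<equiv> jump_moment K 1"
abbreviation "m\<^sub>2 \<equiv> jump_moment K 2"

text \<open>
  A bound, uniform in the state, for the second moment of the jump restricted to \<open>\<xi>\<^sup>2 > T\<close>.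
\<close>

definition \<rho> :: "real \<Rightarrow> real" where
  "\<rho> T = (\<integral>y. \<Xi> y * indicator {y. \<Xi> y > T} y \<partial>N)"

lemma \<rho>_tendsto: "(\<rho> \<longlongrightarrow> 0) at_top"
  unfolding \<rho>_def by (rule truncated_tail_tendsto_0) (rule \<Xi>)

lemma jump_measurable: "x \<ge> 0 \<Longrightarrow> (\<lambda>z. z - x) \<in> borel_measurable (K x)"
  unfolding measurable_K by (rule borel_measurable_Rplus) measurable

lemma jump_moment_eq:
  assumes "x \<ge> 0"
  shows "jump_moment K k x = (\<integral>z. (z - x) ^ k \<partial>K x)"
  unfolding jump_moment_def jump_law_def
  by (subst integral_distr) (auto intro: jump_measurable assms)

lemma truncated_second_moment:
  assumes x: "x \<ge> 0" and T: "T \<ge> 0"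
  shows "integrable (K x) (\<lambda>z. (z - x)\<^sup>2 * indicator {z. (z - x)\<^sup>2 > T} z)"
    and "(\<integral>z. (z - x)\<^sup>2 * indicator {z. (z - x)\<^sup>2 > T} z \<partial>K x) \<le> \<rho> T"
proof -
  note [measurable] = jump_measurable[OF x]
  interpret Kx: prob_space "K x" using prob_space_K x .
  have P: "prob_space (jump_law K x)"
    unfolding jump_law_def by (rule Kx.prob_space_distr) measurable
  have f: "(\<lambda>z. z\<^sup>2) \<in> borel_measurable (jump_law K x)"
    by (simp add: jump_law_def)
  note * = st_le_tail_integral[OF P \<Xi>(1) f \<Xi>(2) domination[OF x] T]
  have ind: "indicator {z. z\<^sup>2 > T} (z - x) = (indicator {z. (z - x)\<^sup>2 > T} z :: real)" for z
    by (simp add: indicator_def)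
  show "integrable (K x) (\<lambda>z. (z - x)\<^sup>2 * indicator {z. (z - x)\<^sup>2 > T} z)"
    using *(1) unfolding jump_law_def by (subst (asm) integrable_distr_eq) (auto simp: ind)
  show "(\<integral>z. (z - x)\<^sup>2 * indicator {z. (z - x)\<^sup>2 > T} z \<partial>K x) \<le> \<rho> T"
    using *(2) unfolding jump_law_def \<rho>_def by (subst (asm) integral_distr) (auto simp: ind)
qed

lemma jump_square_integrable: "x \<ge> 0 \<Longrightarrow> integrable (K x) (\<lambda>z. (z - x)\<^sup>2)"
  and m2_le: "x \<ge> 0 \<Longrightarrow> m\<^sub>2 x \<le> \<rho> 0"
  and m2_nonneg: "x \<ge> 0 \<Longrightarrow> 0 \<le> m\<^sub>2 x"
proof -
  assume x: "x \<ge> 0"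
  have "(\<lambda>z. (z - x)\<^sup>2 * indicator {z. (z - x)\<^sup>2 > 0} z) = (\<lambda>z. (z - x)\<^sup>2)"
    by (auto simp: indicator_def)
  with truncated_second_moment[OF x order_refl]
  show "integrable (K x) (\<lambda>z. (z - x)\<^sup>2)" "m\<^sub>2 x \<le> \<rho> 0" "0 \<le> m\<^sub>2 x"
    by (simp_all add: jump_moment_eq x)
qed

lemma \<rho>0_nonneg: "0 \<le> \<rho> 0"
  using m2_le[of 0] m2_nonneg[of 0] by simp

lemma jump_integrable: "x \<ge> 0 \<Longrightarrow> integrable (K x) (\<lambda>z. z - x)"
  and m1_le: "x \<ge> 0 \<Longrightarrow> \<bar>m\<^sub>1 x\<bar> \<le> 1 + \<rho> 0"
proof -
  assume x: "x \<ge> 0"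
  interpret Kx: prob_space "K x" using prob_space_K x .
  note [measurable] = jump_measurable[OF x]
  have bound: "\<bar>z - x\<bar> \<le> 1 + (z - x)\<^sup>2" for z
    using zero_le_power2[of "\<bar>z - x\<bar> - 1/2"] by (simp add: power2_diff power_divide)
  have i: "integrable (K x) (\<lambda>z. 1 + (z - x)\<^sup>2)"
    using jump_square_integrable[OF x] by simp
  show int: "integrable (K x) (\<lambda>z. z - x)"
    by (rule Bochner_Integration.integrable_bound[OF i]) (use bound in \<open>auto intro: order_trans\<close>)
  have "\<bar>m\<^sub>1 x\<bar> \<le> (\<integral>z. \<bar>z - x\<bar> \<partial>K x)"
    unfolding jump_moment_eq[OF x] power_one_right by (rule integral_abs_bound)
  also have "\<dots> \<le> (\<integral>z. 1 + (z - x)\<^sup>2 \<partial>K x)"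
    using int i bound by (intro integral_mono) auto
  also have "\<dots> = 1 + m\<^sub>2 x"
    using jump_square_integrable[OF x] by (simp add: jump_moment_eq x Kx.prob_space)
  finally show "\<bar>m\<^sub>1 x\<bar> \<le> 1 + \<rho> 0" using m2_le[OF x] by simp
qed

definition mean_quad :: "real \<Rightarrow> real \<Rightarrow> real \<Rightarrow> real" where
  "mean_quad a s x = lyap (a + 1) s x *
     (2 * a * (a + 1) * (x\<^sup>2 / (s + x\<^sup>2)) * m\<^sub>2 x - a * (2 * x * m\<^sub>1 x + m\<^sub>2 x))"

lemma integral_lyap_quad:
  assumes x: "x \<ge> 0" and s: "s > 0"
  shows "integrable (K x) (\<lambda>z. lyap_quad a s x (z - x))"
    and "(\<integral>z. lyap_quad a s x (z - x) \<partial>K x) = lyap a s x + mean_quad a s x"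
proof -
  interpret Kx: prob_space "K x" using prob_space_K x .
  define t where "t = s + x\<^sup>2"
  have t: "t > 0" using s by (simp add: t_def add_pos_nonneg)
  have eq: "lyap_quad a s x (z - x) = lyap a s x
      + lyap a s x * (- 2 * a * x / t) * (z - x)
      + lyap a s x * (2 * a * (a + 1) * x\<^sup>2 / t\<^sup>2 - a / t) * (z - x)\<^sup>2" for z
    by (simp add: lyap_quad_def algebra_simps add_divide_distrib diff_divide_distrib flip: t_def)
  note i = jump_integrable[OF x] jump_square_integrable[OF x]
  show "integrable (K x) (\<lambda>z. lyap_quad a s x (z - x))"
    unfolding eq using i by simp
  have "(\<integral>z. lyap_quad a s x (z - x) \<partial>K x) = lyap a s x
      + lyap a s x * (- 2 * a * x / t) * m\<^sub>1 x
      + lyap a s x * (2 * a * (a + 1) * x\<^sup>2 / t\<^sup>2 - a / t) * m\<^sub>2 x"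
    unfolding eq using i by (simp add: jump_moment_eq x Kx.prob_space)
  also have "\<dots> = lyap a s x + mean_quad a s x"
    using t unfolding mean_quad_def lyap_plus_1[OF s] t_def[symmetric]
    by (simp add: power2_eq_square field_simps)
  finally show "(\<integral>z. lyap_quad a s x (z - x) \<partial>K x) = lyap a s x + mean_quad a s x" .
qed

definition left_prob :: "real \<Rightarrow> real" where
  "left_prob x = measure (jump_law K x) {z. z \<le> - \<gamma> * x}"

lemma left_prob_eq:
  assumes x: "x \<ge> 0"
  shows "left_prob x = (\<integral>z. of_bool (z - x \<le> - \<gamma> * x) \<partial>K x)"
    and "integrable (K x) (\<lambda>z. of_bool (z - x \<le> - \<gamma> * x) :: real)"
proof -
  interpret Kx: prob_space "K x" using prob_space_K x .
  note [measurable] = jump_measurable[OF x]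
  let ?A = "(\<lambda>z. z - x) -` {z. z \<le> - \<gamma> * x} \<inter> space (K x)"
  have A: "?A \<in> sets (K x)" by measurable
  have "integrable (K x) (\<lambda>z. of_bool (z - x \<le> - \<gamma> * x) :: real) \<longleftrightarrow> integrable (K x) (indicator ?A :: real \<Rightarrow> real)"
    by (intro Bochner_Integration.integrable_cong) (auto simp: indicator_def)
  then show "integrable (K x) (\<lambda>z. of_bool (z - x \<le> - \<gamma> * x) :: real)"
    using A by (simp add: Kx.emeasure_eq_measure)
  have "left_prob x = measure (K x) ?A"
    unfolding left_prob_def jump_law_def by (intro measure_distr) measurable
  also have "\<dots> = (\<integral>z. indicator ?A z \<partial>K x)"
    using A by simp
  also have "\<dots> = (\<integral>z. of_bool (z - x \<le> - \<gamma> * x) \<partial>K x)"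
    by (intro Bochner_Integration.integral_cong) (auto simp: indicator_def)
  finally show "left_prob x = (\<integral>z. of_bool (z - x \<le> - \<gamma> * x) \<partial>K x)" .
qed

lemma left_prob_nonneg: "0 \<le> left_prob x"
  by (simp add: left_prob_def)

lemma lyap_integrable: "x \<ge> 0 \<Longrightarrow> a \<ge> 0 \<Longrightarrow> s > 0 \<Longrightarrow> integrable (K x) (lyap a s)"
  by (rule integrable_bounded_K[where B = "s powr (- a)"]) (auto simp: lyap_le)

lemma generator_lyap_expansion:
  assumes a: "a > 0"
  obtains C1 where "C1 \<ge> 0"
    "\<And>\<eta>. 0 < \<eta> \<Longrightarrow> \<eta> \<le> 1/6 \<Longrightarrow> \<exists>C2\<ge>0. \<forall>s>0. \<forall>x\<ge>0.
       \<bar>generator (lyap a s) x - mean_quad a s x\<bar>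
         \<le> lyap (a + 1) s x * (C1 * \<eta> + C2 * \<rho> (\<eta>\<^sup>2 * s))
           + s powr (- a) * of_bool (x\<^sup>2 > s) * left_prob x"
proof (rule lyap_expansion[OF a \<gamma>])
  fix C1 assume C1: "0 \<le> C1" and
    exp: "\<And>\<eta>. 0 < \<eta> \<Longrightarrow> \<eta> \<le> 1/6 \<Longrightarrow> \<exists>C2\<ge>0. \<forall>s>0. \<forall>x\<ge>0. \<forall>z\<ge>0.
       \<bar>lyap a s z - lyap_quad a s x (z - x)\<bar>
         \<le> lyap a s x / (s + x\<^sup>2) * (C1 * \<eta> * (z - x)\<^sup>2
             + C2 * ((z - x)\<^sup>2 * indicator {z. (z - x)\<^sup>2 > \<eta>\<^sup>2 * s} z))
           + s powr (- a) * of_bool (x\<^sup>2 > s \<and> z - x \<le> - \<gamma> * x)"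
  show thesis
  proof (rule that[of "C1 * \<rho> 0"])
    show "0 \<le> C1 * \<rho> 0" using C1 \<rho>0_nonneg by simp
    fix \<eta> :: real assume \<eta>: "0 < \<eta>" "\<eta> \<le> 1/6"
    from exp[OF this] obtain C2 where C2: "C2 \<ge> 0"
      and bound: "\<And>s x z. s > 0 \<Longrightarrow> x \<ge> 0 \<Longrightarrow> z \<ge> 0 \<Longrightarrow> \<bar>lyap a s z - lyap_quad a s x (z - x)\<bar>
         \<le> lyap a s x / (s + x\<^sup>2) * (C1 * \<eta> * (z - x)\<^sup>2
             + C2 * ((z - x)\<^sup>2 * indicator {z. (z - x)\<^sup>2 > \<eta>\<^sup>2 * s} z))
           + s powr (- a) * of_bool (x\<^sup>2 > s \<and> z - x \<le> - \<gamma> * x)" by blast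
    show "\<exists>C2\<ge>0. \<forall>s>0. \<forall>x\<ge>0. \<bar>generator (lyap a s) x - mean_quad a s x\<bar>
         \<le> lyap (a + 1) s x * (C1 * \<rho> 0 * \<eta> + C2 * \<rho> (\<eta>\<^sup>2 * s))
           + s powr (- a) * of_bool (x\<^sup>2 > s) * left_prob x"
    proof (intro exI[of _ C2] conjI C2 allI impI)
      fix s x :: real assume s: "s > 0" and x: "x \<ge> 0"
      let ?T = "\<lambda>z. (z - x)\<^sup>2 * indicator {z. (z - x)\<^sup>2 > \<eta>\<^sup>2 * s} z"
      note q = integral_lyap_quad[OF x s, of a]
      note T = truncated_second_moment[OF x, of "\<eta>\<^sup>2 * s"]
      have i: "integrable (K x) (\<lambda>z. lyap a s z - lyap_quad a s x (z - x))"
        using a s x by (intro Bochner_Integration.integrable_diff q lyap_integrable) auto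
      have "generator (lyap a s) x - mean_quad a s x = (\<integral>z. lyap a s z - lyap_quad a s x (z - x) \<partial>K x)"
        using a s x q by (subst Bochner_Integration.integral_diff) (auto simp: generator_def lyap_integrable)
      then have "\<bar>generator (lyap a s) x - mean_quad a s x\<bar> \<le> (\<integral>z. \<bar>lyap a s z - lyap_quad a s x (z - x)\<bar> \<partial>K x)"
        using integral_abs_bound by metis
      also have "\<dots> \<le> (\<integral>z. lyap (a + 1) s x * (C1 * \<eta> * (z - x)\<^sup>2 + C2 * ?T z)
           + s powr (- a) * of_bool (x\<^sup>2 > s) * of_bool (z - x \<le> - \<gamma> * x) \<partial>K x)"
      proof (rule integral_mono)
        show "integrable (K x) (\<lambda>z. lyap (a + 1) s x * (C1 * \<eta> * (z - x)\<^sup>2 + C2 * ?T z)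
           + s powr (- a) * of_bool (x\<^sup>2 > s) * of_bool (z - x \<le> - \<gamma> * x))"
          using T(1) jump_square_integrable[OF x] left_prob_eq(2)[OF x] s
          by (intro Bochner_Integration.integrable_add integrable_mult_right) auto
      qed (use i bound[OF s x] in \<open>auto simp: space_K x lyap_plus_1 s of_bool_conj mult.assoc\<close>)
      also have "\<dots> = lyap (a + 1) s x * (C1 * \<eta> * m\<^sub>2 x + C2 * (\<integral>z. ?T z \<partial>K x))
           + s powr (- a) * of_bool (x\<^sup>2 > s) * left_prob x"
        using T(1) jump_square_integrable[OF x] left_prob_eq[OF x] s
        by (simp add: jump_moment_eq x)
      also have "\<dots> \<le> lyap (a + 1) s x * (C1 * \<eta> * \<rho> 0 + C2 * \<rho> (\<eta>\<^sup>2 * s))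
           + s powr (- a) * of_bool (x\<^sup>2 > s) * left_prob x"
        using C1 C2 \<eta> s T(2) m2_le[OF x]
        by (intro add_right_mono mult_left_mono add_mono) auto
      finally show "\<bar>generator (lyap a s) x - mean_quad a s x\<bar>
         \<le> lyap (a + 1) s x * (C1 * \<rho> 0 * \<eta> + C2 * \<rho> (\<eta>\<^sup>2 * s))
           + s powr (- a) * of_bool (x\<^sup>2 > s) * left_prob x"
        by (simp add: ac_simps)
    qed
  qed
qed

lemma left_prob_eventually_le:
  assumes "\<kappa> > 0"
  shows "eventually (\<lambda>x. left_prob x \<le> \<kappa> * x powr (- 2 - \<delta>)) at_top"
proof -
  \<comment> \<open>The second moment in the hypothesis is at most \<open>\<rho> 0\<close>; adding 1 keeps the denominator positive.\<close>
  define c where "c = \<kappa> / (1 + \<rho> 0)"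
  have c: "c > 0" using assms \<rho>0_nonneg by (simp add: c_def)
  from landau_o.smallD[OF left_tail c] eventually_ge_at_top[of 0]
  show ?thesis
  proof eventually_elim
    case (elim x)
    have "left_prob x \<le> c * (m\<^sub>2 x * x powr (- 2 - \<delta>))"
      using elim m2_nonneg[of x]
      by (simp add: left_prob_def powr_diff powr_minus powr_add divide_simps mult_ac)
    also have "\<dots> \<le> c * ((1 + \<rho> 0) * x powr (- 2 - \<delta>))"
      using c elim m2_le[of x] by (intro mult_left_mono mult_right_mono) auto
    also have "\<dots> = \<kappa> * x powr (- 2 - \<delta>)"
      using \<rho>0_nonneg by (simp add: c_def)
    finally show ?case .
  qed
qed

text \<open>
  The condition \<open>left_tail\<close> in the form in which it is used. For \<open>x\<^sup>2 > s\<close> the quantities \<open>x\<^sup>2\<close> and \<open>s + x\<^sup>2\<close> are comparable,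
  and \<open>x\<^bsup>-2-\<delta>\<^esup> \<le> (x\<^sup>2)\<^bsup>-(d+1)\<^esup>\<close> because \<open>2d \<le> \<delta>\<close>.
\<close>

lemma left_prob_le_lyap:
  assumes "\<kappa> > 0" "d > 0" "2 * d \<le> \<delta>"
  shows "eventually (\<lambda>s. \<forall>x\<ge>0. x\<^sup>2 > s \<longrightarrow> left_prob x \<le> \<kappa> * lyap (d + 1) s x) at_top"
proof -
  define c where "c = \<kappa> / 2 powr (d + 1)"
  have c: "c > 0" using assms by (simp add: c_def)
  from left_prob_eventually_le[OF this] obtain A0
    where A0: "\<And>x. x \<ge> A0 \<Longrightarrow> left_prob x \<le> c * x powr (- 2 - \<delta>)"
    by (auto simp: eventually_at_top_linorder)
  define A where "A = max A0 1"
  show ?thesis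
    using eventually_ge_at_top[of "A\<^sup>2"]
  proof eventually_elim
    case (elim s)
    show ?case
    proof (intro allI impI)
      fix x assume x: "x \<ge> 0" "x\<^sup>2 > s"
      have "A\<^sup>2 < x\<^sup>2" using elim x by simp
      then have Ax: "A \<le> x" using x power2_less_imp_less[of A x] by simp
      then have x1: "x \<ge> 1" by (simp add: A_def)
      have s: "s > 0" using elim by (rule less_le_trans[rotated]) (simp add: A_def)
      have "x powr (- 2 - \<delta>) \<le> x powr (- 2 * (d + 1))"
        using assms x1 by (intro powr_mono) auto
      also have "\<dots> = (x\<^sup>2) powr (- (d + 1))"
        using x1 by (simp add: powr_powr algebra_simps flip: powr_numeral)
      also have "\<dots> \<le> ((s + x\<^sup>2) / 2) powr (- (d + 1))"
        using assms x s by (intro powr_mono2') auto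
      also have "\<dots> = 2 powr (d + 1) * lyap (d + 1) s x"
        using s unfolding lyap_def
        by (subst powr_divide) (simp_all only: powr_minus_divide[of 2 "d + 1"], simp_all)
      finally have "c * x powr (- 2 - \<delta>) \<le> c * (2 powr (d + 1) * lyap (d + 1) s x)"
        using c by (intro mult_left_mono) auto
      moreover have "left_prob x \<le> c * x powr (- 2 - \<delta>)" using A0 Ax by (simp add: A_def)
      ultimately show "left_prob x \<le> \<kappa> * lyap (d + 1) s x"
        by (simp add: c_def)
    qed
  qed
qed

text \<open>
  All errors are expressed through \<open>s\<^bsup>d-a\<^esup> lyap (d + 1) s\<close>, whose integral against the Green measure will
  turn out to be \<open>O(s\<^bsup>-a\<^esup>)\<close>, the order of the main terms.
\<close>

lemma generator_lyap_approx:
  assumes d: "0 < d" "2 * d \<le> \<delta>" and a: "d \<le> a" and \<kappa>: "\<kappa> > 0"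
  shows "eventually (\<lambda>s. \<forall>x\<ge>0. \<bar>generator (lyap a s) x - mean_quad a s x\<bar>
           \<le> \<kappa> * (s powr (d - a) * lyap (d + 1) s x)) at_top"
proof -
  have "a > 0" using a d by simp
  from generator_lyap_expansion[OF this] obtain C1 where C1: "C1 \<ge> 0" and
    exp: "\<And>\<eta>. 0 < \<eta> \<Longrightarrow> \<eta> \<le> 1/6 \<Longrightarrow> \<exists>C2\<ge>0. \<forall>s>0. \<forall>x\<ge>0.
       \<bar>generator (lyap a s) x - mean_quad a s x\<bar>
         \<le> lyap (a + 1) s x * (C1 * \<eta> + C2 * \<rho> (\<eta>\<^sup>2 * s))
           + s powr (- a) * of_bool (x\<^sup>2 > s) * left_prob x" by blast
  \<comment> \<open>First \<open>\<eta>\<close> is chosen to make the small jumps contribute at most \<open>\<kappa>/4\<close>; after that \<open>C2\<close> is a constant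
    and large \<open>s\<close> makes the large jumps contribute as little. Half of \<open>\<kappa>\<close> is left for \<open>left_prob\<close>.\<close>
  define \<eta> where "\<eta> = min (1/6) (\<kappa> / (4 * (1 + C1)))"
  have \<eta>: "0 < \<eta>" "\<eta> \<le> 1/6" using \<kappa> C1 unfolding \<eta>_def by (simp, intro min.cobounded1)
  have "C1 * \<eta> \<le> C1 * (\<kappa> / (4 * (1 + C1)))"
    using C1 by (intro mult_left_mono) (auto simp: \<eta>_def)
  also have "\<dots> \<le> \<kappa> / 4" using C1 \<kappa> by (simp add: field_simps)
  finally have C1\<eta>: "C1 * \<eta> \<le> \<kappa> / 4" .
  from exp[OF \<eta>] obtain C2 where C2: "C2 \<ge> 0" and
    bound: "\<And>s x. s > 0 \<Longrightarrow> x \<ge> 0 \<Longrightarrow> \<bar>generator (lyap a s) x - mean_quad a s x\<bar>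
         \<le> lyap (a + 1) s x * (C1 * \<eta> + C2 * \<rho> (\<eta>\<^sup>2 * s))
           + s powr (- a) * of_bool (x\<^sup>2 > s) * left_prob x" by blast
  have "filterlim (\<lambda>s. \<eta>\<^sup>2 * s) at_top at_top"
    using \<eta> by (intro filterlim_tendsto_pos_mult_at_top[OF tendsto_const]) (auto simp: filterlim_ident)
  then have "((\<lambda>s. C2 * \<rho> (\<eta>\<^sup>2 * s)) \<longlongrightarrow> C2 * 0) at_top"
    by (intro tendsto_mult_left filterlim_compose[OF \<rho>_tendsto])
  then have ev: "eventually (\<lambda>s. C2 * \<rho> (\<eta>\<^sup>2 * s) < \<kappa> / 4) at_top"
    using \<kappa> by (auto dest: order_tendstoD(2)[where a = "\<kappa>/4"])
  have "\<kappa> / 2 > 0" using \<kappa> by simp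
  from left_prob_le_lyap[OF this d] ev eventually_ge_at_top[of 1]
  show ?thesis
  proof eventually_elim
    case (elim s)
    show ?case
    proof (intro allI impI)
      fix x :: real assume x: "x \<ge> 0"
      have s: "s > 0" using elim by simp
      have "lyap (a + 1) s x * (C1 * \<eta> + C2 * \<rho> (\<eta>\<^sup>2 * s)) \<le> lyap (a + 1) s x * (\<kappa> / 2)"
        using elim C1\<eta> by (intro mult_left_mono) auto
      also have "\<dots> \<le> (s powr (d - a) * lyap (d + 1) s x) * (\<kappa> / 2)"
        using \<kappa> lyap_exponent_le[of "d + 1" "a + 1" s x] a s by (intro mult_right_mono) auto
      finally have 1: "lyap (a + 1) s x * (C1 * \<eta> + C2 * \<rho> (\<eta>\<^sup>2 * s))
          \<le> \<kappa> / 2 * (s powr (d - a) * lyap (d + 1) s x)" by (simp add: ac_simps)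
      have "s powr (- a) * of_bool (x\<^sup>2 > s) * left_prob x \<le> s powr (d - a) * (\<kappa> / 2 * lyap (d + 1) s x)"
      proof (cases "x\<^sup>2 > s")
        case True
        then have "s powr (- a) * left_prob x \<le> s powr (d - a) * (\<kappa> / 2 * lyap (d + 1) s x)"
          using elim x d by (intro mult_mono powr_mono) (auto simp: left_prob_nonneg)
        then show ?thesis using True by simp
      qed (use \<kappa> in auto)
      with 1 show "\<bar>generator (lyap a s) x - mean_quad a s x\<bar>
           \<le> \<kappa> * (s powr (d - a) * lyap (d + 1) s x)"
        using bound[OF s x] by (simp add: algebra_simps)
    qed
  qed
qed

section \<open>A priori bound on the Green measure\<close>

lemma x_m1_tendsto: "((\<lambda>x. x * m\<^sub>1 x) \<longlongrightarrow> \<mu>) at_top"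
proof -
  have "(\<lambda>x. x * m\<^sub>1 x) \<sim>[at_top] (\<lambda>x. x * (\<mu> / x))"
    by (rule asymp_equiv_mult[OF asymp_equiv_refl m1])
  moreover have "((\<lambda>x. x * (\<mu> / x)) \<longlongrightarrow> \<mu>) at_top"
  proof (rule tendsto_eventually)
    show "eventually (\<lambda>x. x * (\<mu> / x) = \<mu>) at_top"
      using eventually_gt_at_top[of 0] by eventually_elim simp
  qed
  ultimately show ?thesis
    using asymp_equiv_symI asymp_equiv_tendsto_transfer by blast
qed

text \<open>
  The bracket in \<open>mean_quad\<close> is negative for three different reasons. Beyond some \<open>A\<close> it is close to
  \<open>- d(2\<mu> - b - 2bd)\<close> or below it. Between \<open>x\<^sub>0\<close> and \<open>A\<close> the condition \<open>drift\<close> makes its second term at most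
  \<open>- d\<epsilon>\<close>, while the first one has a factor \<open>x\<^sup>2/(s + x\<^sup>2)\<close> that vanishes as \<open>s \<rightarrow> \<infinity>\<close>. On \<open>[0, x\<^sub>0]\<close> it is only
  bounded, which \<open>D\<close> compensates.
\<close>

lemma lyapunov_drift:
  assumes d: "0 < d" "2 * b * d < 2 * \<mu> - b"
  obtains c D where "c > 0" "D \<ge> 0"
    "eventually (\<lambda>s. \<forall>x\<ge>0. mean_quad d s x \<le> lyap (d + 1) s x * (- 2 * c + D * of_bool (x \<le> x0))) at_top"
proof -
  define \<beta> where "\<beta> s x = 2 * d * (d + 1) * (x\<^sup>2 / (s + x\<^sup>2)) * m\<^sub>2 x - d * (2 * x * m\<^sub>1 x + m\<^sub>2 x)" for s x
  \<comment> \<open>As \<open>x \<rightarrow> \<infinity>\<close>, replacing \<open>x\<^sup>2/(s + x\<^sup>2)\<close> by its upper bound 1 makes \<open>\<beta> s x\<close> converge to \<open>- e\<close>.\<close>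
  define e where "e = d * (2 * \<mu> - b - 2 * b * d)"
  have e: "e > 0" using d by (simp add: e_def)
  define c where "c = min (e / 4) (d * \<epsilon> / 4)"
  have c: "c > 0" using d e params by (simp add: c_def)
  define D where "D = 2 * c + d * \<epsilon>0 + 2 * d * (d + 1) * \<rho> 0"
  have D: "D \<ge> 0" using c d params \<rho>0_nonneg by (simp add: D_def)
  have "((\<lambda>x. 2 * d * (d + 1) * m\<^sub>2 x - d * (2 * (x * m\<^sub>1 x) + m\<^sub>2 x))
      \<longlongrightarrow> 2 * d * (d + 1) * b - d * (2 * \<mu> + b)) at_top"
    by (intro tendsto_intros m2 x_m1_tendsto)
  moreover have "2 * d * (d + 1) * b - d * (2 * \<mu> + b) = - e"
    by (simp add: e_def algebra_simps)
  then have "2 * d * (d + 1) * b - d * (2 * \<mu> + b) < - (e / 2)"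
    using e by linarith
  ultimately have "eventually (\<lambda>x. 2 * d * (d + 1) * m\<^sub>2 x - d * (2 * (x * m\<^sub>1 x) + m\<^sub>2 x) < - (e / 2)) at_top"
    by (rule order_tendstoD)
  then obtain A where A: "\<And>x. x \<ge> A \<Longrightarrow> 2 * d * (d + 1) * m\<^sub>2 x - d * (2 * (x * m\<^sub>1 x) + m\<^sub>2 x) < - (e / 2)"
    by (auto simp: eventually_at_top_linorder)
  have quad: "2 * d * (d + 1) * (x\<^sup>2 / (s + x\<^sup>2)) * m\<^sub>2 x \<le> 2 * d * (d + 1) * r * m\<^sub>2 x"
    if "x\<^sup>2 / (s + x\<^sup>2) \<le> r" "x \<ge> 0" for s x r
    using that d m2_nonneg[of x] by (intro mult_right_mono mult_left_mono) auto
  have ratio: "x\<^sup>2 / (s + x\<^sup>2) \<le> 1" if "s > 0" for s x :: real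
    using that by (simp add: divide_le_eq_1 add_pos_nonneg)
  have small: "eventually (\<lambda>s. 2 * d * (d + 1) * (A\<^sup>2 / s) * \<rho> 0 < d * \<epsilon> / 2) at_top"
  proof -
    have "((\<lambda>s. 2 * d * (d + 1) * (A\<^sup>2 / s) * \<rho> 0) \<longlongrightarrow> 2 * d * (d + 1) * 0 * \<rho> 0) at_top"
      by (intro tendsto_intros tendsto_divide_0[OF tendsto_const] filterlim_at_top_imp_at_infinity filterlim_ident)
    then show ?thesis using d params by (intro order_tendstoD) auto
  qed
  show thesis
  proof (rule that[OF c D])
    show "eventually (\<lambda>s. \<forall>x\<ge>0. mean_quad d s x
        \<le> lyap (d + 1) s x * (- 2 * c + D * of_bool (x \<le> x0))) at_top"
      using small eventually_gt_at_top[of 0]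
    proof eventually_elim
      case (elim s)
      show ?case
      proof (intro allI impI)
        fix x :: real assume x: "x \<ge> 0"
        have "\<beta> s x \<le> - 2 * c + D * of_bool (x \<le> x0)"
        proof -
          consider "x \<le> x0" | "x0 < x" "x < A" | "x0 < x" "A \<le> x" by linarith
          then show ?thesis
          proof cases
            case 1
            have "2 * d * (d + 1) * (x\<^sup>2 / (s + x\<^sup>2)) * m\<^sub>2 x \<le> 2 * d * (d + 1) * 1 * m\<^sub>2 x"
              using elim by (intro quad ratio x) auto
            also have "\<dots> \<le> 2 * d * (d + 1) * 1 * \<rho> 0"
              using d m2_le[OF x] by (intro mult_left_mono) auto
            finally have "2 * d * (d + 1) * (x\<^sup>2 / (s + x\<^sup>2)) * m\<^sub>2 x \<le> 2 * d * (d + 1) * \<rho> 0"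
              by simp
            moreover have "d * (- \<epsilon>0) \<le> d * (2 * x * m\<^sub>1 x + m\<^sub>2 x)"
              using drift[OF x] 1 d by (intro mult_left_mono) auto
            ultimately show ?thesis using 1 by (simp add: \<beta>_def D_def)
          next
            case 2
            have "x\<^sup>2 \<le> A\<^sup>2" using 2 x by (intro power_mono) auto
            then have "x\<^sup>2 / (s + x\<^sup>2) \<le> A\<^sup>2 / s" using elim by (intro frac_le) auto
            from quad[OF this x] have "2 * d * (d + 1) * (x\<^sup>2 / (s + x\<^sup>2)) * m\<^sub>2 x \<le> 2 * d * (d + 1) * (A\<^sup>2 / s) * m\<^sub>2 x" .
            also have "\<dots> \<le> 2 * d * (d + 1) * (A\<^sup>2 / s) * \<rho> 0"
              using d elim m2_le[OF x] by (intro mult_left_mono) auto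
            finally have "2 * d * (d + 1) * (x\<^sup>2 / (s + x\<^sup>2)) * m\<^sub>2 x \<le> d * \<epsilon> / 2" using elim by simp
            moreover have "d * \<epsilon> \<le> d * (2 * x * m\<^sub>1 x + m\<^sub>2 x)"
              using drift[OF x] 2 d by (intro mult_left_mono) auto
            moreover have "c \<le> d * \<epsilon> / 4" by (simp add: c_def)
            ultimately show ?thesis using 2 by (simp add: \<beta>_def)
          next
            case 3
            have "\<beta> s x \<le> 2 * d * (d + 1) * m\<^sub>2 x - d * (2 * (x * m\<^sub>1 x) + m\<^sub>2 x)"
              using quad[OF ratio x, of s] elim by (simp add: \<beta>_def mult.assoc)
            moreover have "c \<le> e / 4" by (simp add: c_def)
            ultimately show ?thesis using A[OF 3(2)] 3 by simp
          qed
        qed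
        then show "mean_quad d s x \<le> lyap (d + 1) s x * (- 2 * c + D * of_bool (x \<le> x0))"
          unfolding mean_quad_def \<beta>_def by (intro mult_left_mono) auto
      qed
    qed
  qed
qed

lemma occupation_finite: "emeasure green {0..x0} < \<infinity>"
proof -
  have "emeasure green {0..x0} \<le> (SUP y\<in>{0..x0}. \<Sum>n. emeasure (law_from K n y) {0..x0})"
    unfolding emeasure_green_Icc by (intro occupation_le SUP_upper)
  then show ?thesis using occupation by (rule le_less_trans)
qed

text \<open>
  The Foster--Lyapunov bound with \<open>h = lyap d s\<close> and \<open>V = c lyap (d + 1) s\<close>; half of the drift \<open>2c\<close> of
  \<open>lyapunov_drift\<close> pays for the error of \<open>generator_lyap_approx\<close>.
\<close>

lemma green_lyap_nn_bound:
  assumes d: "0 < d" "2 * d \<le> \<delta>" "2 * b * d < 2 * \<mu> - b"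
  obtains C where "C \<ge> 0"
    "eventually (\<lambda>s. (\<integral>\<^sup>+x. lyap (d + 1) s x \<partial>green) \<le> ennreal (C * s powr (- d))) at_top"
proof -
  obtain c D where c: "c > 0" and D: "D \<ge> 0" and
    quad: "eventually (\<lambda>s. \<forall>x\<ge>0. mean_quad d s x
        \<le> lyap (d + 1) s x * (- 2 * c + D * of_bool (x \<le> x0))) at_top"
    using lyapunov_drift[OF d(1,3)] .
  define B where "B = enn2real (emeasure green {0..x0})"
  have "(\<integral>\<^sup>+x. indicator {0..x0} x \<partial>green) = emeasure green {0..x0}"
    by (intro nn_integral_indicator) (auto simp: sets_restrict_space_iff)
  then have B: "(\<integral>\<^sup>+x. indicator {0..x0} x \<partial>green) = ennreal B" "B \<ge> 0"
    using occupation_finite by (auto simp: B_def)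
  define C where "C = (1 + D * B) / c"
  have "eventually (\<lambda>s. (\<integral>\<^sup>+x. lyap (d + 1) s x \<partial>green) \<le> ennreal (C * s powr (- d))) at_top"
    using quad generator_lyap_approx[OF d(1,2) order_refl c] eventually_ge_at_top[of 1]
  proof eventually_elim
    case (elim s)
    have s: "s > 0" "s \<ge> 1" using elim by auto
    define D' where "D' = D * s powr (- (d + 1))"
    have D': "D' \<ge> 0" using D by (simp add: D'_def)
    have drift: "(\<integral>z. lyap d s z \<partial>K x) + c * lyap (d + 1) s x \<le> lyap d s x + D' * indicator {0..x0} x"
      if x: "x \<ge> 0" for x
    proof -
      have "generator (lyap d s) x \<le> mean_quad d s x + c * lyap (d + 1) s x"
        using elim(2) x s by (auto dest!: spec[of _ x])
      also have "\<dots> \<le> lyap (d + 1) s x * (- 2 * c + D * of_bool (x \<le> x0)) + c * lyap (d + 1) s x"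
        using elim(1) x by auto
      also have "\<dots> = - c * lyap (d + 1) s x + D * lyap (d + 1) s x * of_bool (x \<le> x0)"
        by (simp add: algebra_simps)
      also have "\<dots> \<le> - c * lyap (d + 1) s x + D' * of_bool (x \<le> x0)"
        unfolding D'_def using D d s by (intro add_left_mono mult_right_mono mult_left_mono lyap_le) auto
      finally show ?thesis
        using x by (simp add: generator_def indicator_def)
    qed
    have "(\<integral>\<^sup>+x. ennreal (c * lyap (d + 1) s x) \<partial>green)
      \<le> (\<integral>\<^sup>+\<omega>. ennreal (lyap d s (X 0 \<omega>)) \<partial>M) + ennreal D' * (\<integral>\<^sup>+x. indicator {0..x0} x \<partial>green)"
    proof (rule foster_bound)
      fix x :: real assume x: "x \<ge> 0"
      have "transition (\<lambda>z. ennreal (lyap d s z)) x = ennreal (\<integral>z. lyap d s z \<partial>K x)"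
        unfolding transition_def using d s x by (intro nn_integral_eq_integral lyap_integrable) auto
      then show "transition (\<lambda>z. ennreal (lyap d s z)) x + ennreal (c * lyap (d + 1) s x)
          \<le> ennreal (lyap d s x) + ennreal D' * indicator {0..x0} x"
        using drift[OF x] D' c
        by (cases "x \<le> x0") (auto simp: x ennreal_plus[symmetric] integral_nonneg_AE simp del: ennreal_plus intro!: ennreal_leI)
    qed (auto simp: sets_restrict_space_iff)
    also have "\<dots> \<le> ennreal (s powr (- d)) + ennreal D' * ennreal B"
    proof (intro add_mono)
      have "(\<integral>\<^sup>+\<omega>. ennreal (lyap d s (X 0 \<omega>)) \<partial>M) \<le> (\<integral>\<^sup>+\<omega>. ennreal (s powr (- d)) \<partial>M)"
        using d s by (intro nn_integral_mono ennreal_leI lyap_le) auto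
      then show "(\<integral>\<^sup>+\<omega>. ennreal (lyap d s (X 0 \<omega>)) \<partial>M) \<le> ennreal (s powr (- d))"
        by (simp add: emeasure_space_1)
    qed (simp add: B)
    also have "\<dots> = ennreal (s powr (- d) + D' * B)"
      using D' B by (simp add: ennreal_mult)
    also have "D' * B \<le> D * B * s powr (- d)"
    proof -
      have "s powr (- (d + 1)) \<le> s powr (- d)" using s by (intro powr_mono) auto
      then have "D * B * s powr (- (d + 1)) \<le> D * B * s powr (- d)"
        using D B by (intro mult_left_mono) auto
      then show ?thesis by (simp add: D'_def ac_simps)
    qed
    finally have le: "(\<integral>\<^sup>+x. ennreal (c * lyap (d + 1) s x) \<partial>green) \<le> ennreal ((1 + D * B) * s powr (- d))"
      by (simp add: algebra_simps ennreal_leI)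
    have "(\<integral>\<^sup>+x. lyap (d + 1) s x \<partial>green) = (\<integral>\<^sup>+x. ennreal (1 / c) * ennreal (c * lyap (d + 1) s x) \<partial>green)"
      using c by (intro nn_integral_cong) (simp flip: ennreal_mult)
    also have "\<dots> = ennreal (1 / c) * (\<integral>\<^sup>+x. ennreal (c * lyap (d + 1) s x) \<partial>green)"
      by (intro nn_integral_cmult) simp
    also have "\<dots> \<le> ennreal (1 / c) * ennreal ((1 + D * B) * s powr (- d))"
      by (intro mult_left_mono le) simp
    also have "\<dots> = ennreal (C * s powr (- d))"
      using c D B by (simp add: C_def flip: ennreal_mult)
    finally show ?case .
  qed
  then show thesis
    using c D B by (intro that[of C]) (auto simp: C_def)
qed

section \<open>Limits of the potentials\<close>

text \<open>
  The power \<open>x\<^bsup>-2q\<^esup>\<close> is harmonic for the limiting operator \<open>(\<mu>/x) h' + (b/2) h''\<close>.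
\<close>

definition q :: real where "q = (2 * \<mu> - b) / (2 * b)"

text \<open>
  An exponent for which the a priori bound is available; the factor \<open>1/2\<close> in \<open>q / 2\<close> only serves to make
  \<open>d < q\<close> strict.
\<close>

definition d :: real where "d = min (\<delta> / 2) (q / 2)"

lemma q_pos: "q > 0" and q_eq: "2 * b * q = 2 * \<mu> - b"
  using b_pos mu_b by (simp_all add: q_def)

lemma d_bounds: "0 < d" "2 * d \<le> \<delta>" "2 * b * d < 2 * \<mu> - b" "d < q"
proof -
  show d: "0 < d" "2 * d \<le> \<delta>" "d < q"
    using \<delta> q_pos by (auto simp: d_def)
  then show "2 * b * d < 2 * \<mu> - b"
    using b_pos by (simp flip: q_eq)
qed

lemma green_lyap_bound:
  obtains C where "C \<ge> 0"
    "eventually (\<lambda>s. integrable green (lyap (d + 1) s) \<and> (\<integral>x. lyap (d + 1) s x \<partial>green) \<le> C * s powr (- d)) at_top"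
proof -
  obtain C where C: "C \<ge> 0"
    and bd: "eventually (\<lambda>s. (\<integral>\<^sup>+x. lyap (d + 1) s x \<partial>green) \<le> ennreal (C * s powr (- d))) at_top"
    using green_lyap_nn_bound[OF d_bounds(1-3)] .
  have "eventually (\<lambda>s. integrable green (lyap (d + 1) s) \<and> (\<integral>x. lyap (d + 1) s x \<partial>green) \<le> C * s powr (- d)) at_top"
    using bd
  proof eventually_elim
    case (elim s)
    have i: "integrable green (lyap (d + 1) s)"
      using elim by (intro integrableI_nonneg) (auto intro: le_less_trans)
    then have "ennreal (\<integral>x. lyap (d + 1) s x \<partial>green) \<le> ennreal (C * s powr (- d))"
      using elim by (subst nn_integral_eq_integral[symmetric]) auto
    then show ?case
      using i C by (simp add: ennreal_le_iff)
  qed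
  with C show thesis by (rule that)
qed

lemma lyap_integrable_green:
  assumes "d \<le> a"
  shows "eventually (\<lambda>s. integrable green (lyap (a + 1) s)) at_top"
proof -
  obtain C where "eventually (\<lambda>s. integrable green (lyap (d + 1) s) \<and> (\<integral>x. lyap (d + 1) s x \<partial>green) \<le> C * s powr (- d)) at_top"
    using green_lyap_bound by metis
  then show ?thesis
    using eventually_gt_at_top[of 0]
  proof eventually_elim
    case (elim s)
    then have i: "integrable green (\<lambda>x. s powr (d - a) * lyap (d + 1) s x)" by simp
    show ?case
      using lyap_exponent_le[of "d + 1" "a + 1" s] elim assms
      by (intro Bochner_Integration.integrable_bound[OF i]) auto
  qed
qed

lemma indicator_integrable_green: "integrable green (indicator {0..A} :: real \<Rightarrow> real)"
proof -
  obtain C where "eventually (\<lambda>s. integrable green (lyap (d + 1) s) \<and> (\<integral>x. lyap (d + 1) s x \<partial>green) \<le> C * s powr (- d)) at_top"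
    using green_lyap_bound by metis
  from eventually_happens'[OF _ eventually_conj[OF this eventually_gt_at_top[of 0]]]
  obtain s where s: "s > 0" "integrable green (lyap (d + 1) s)"
    by auto
  let ?c = "(s + A\<^sup>2) powr (d + 1)"
  have i: "integrable green (\<lambda>x. ?c * lyap (d + 1) s x)" using s by simp
  have le: "indicator {0..A} x \<le> ?c * lyap (d + 1) s x" for x
  proof (cases "x \<in> {0..A}")
    case True
    then have "s + x\<^sup>2 \<le> s + A\<^sup>2" by (auto intro: power_mono)
    then have "(s + A\<^sup>2) powr (- (d + 1)) \<le> lyap (d + 1) s x"
      unfolding lyap_def using s d_bounds by (intro powr_mono2') (auto simp: add_pos_nonneg)
    then have "?c * (s + A\<^sup>2) powr (- (d + 1)) \<le> ?c * lyap (d + 1) s x"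
      by (intro mult_left_mono) auto
    moreover have "s + A\<^sup>2 > 0" using s by (simp add: add_pos_nonneg)
    ultimately show ?thesis using True by (simp flip: powr_add)
  qed simp
  show ?thesis
  proof (rule Bochner_Integration.integrable_bound[OF i])
    show "indicat_real {0..A} \<in> borel_measurable green"
      by (intro borel_measurable_indicator) (auto simp: sets_restrict_space_iff)
  qed (use le in auto)
qed

text \<open>
  Transience: a bounded interval is visited finitely often on average, so the probability of being in it
  tends to 0, and outside a large interval the test function is small.
\<close>

lemma expectation_lyap_vanishes:
  assumes a: "a > 0" and s: "s > 0"
  shows "(\<lambda>n. \<integral>\<omega>. lyap a s (X n \<omega>) \<partial>M) \<longlonglongrightarrow> 0"
proof -
  let ?p = "\<lambda>A n. \<integral>\<omega>. indicat_real {0..A} (X n \<omega>) \<partial>M"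
  have p: "?p A \<longlonglongrightarrow> 0" for A
    using integral_green_sums[OF indicator_integrable_green] by (intro summable_LIMSEQ_zero sums_summable)
  have le: "(\<integral>\<omega>. lyap a s (X n \<omega>) \<partial>M) \<le> s powr (- a) * ?p A n + (A\<^sup>2) powr (- a)" if A: "A > 0" for n A
  proof -
    have i: "integrable M (\<lambda>\<omega>. indicator {0..A} (X n \<omega>) :: real)"
      by (intro integrable_const_bound[where B = 1]) (auto simp: indicator_def)
    have "(\<integral>\<omega>. lyap a s (X n \<omega>) \<partial>M) \<le> (\<integral>\<omega>. s powr (- a) * indicator {0..A} (X n \<omega>) + (A\<^sup>2) powr (- a) \<partial>M)"
    proof (rule integral_mono)
      show "integrable M (\<lambda>\<omega>. lyap a s (X n \<omega>))"
        using a s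
        by (intro integrable_const_bound[where B = "s powr (- a)"] AE_I2 measurable_compose[OF X_measurable lyap_borel])
          (simp add: lyap_le)
      fix \<omega> assume \<omega>: "\<omega> \<in> space M"
      show "lyap a s (X n \<omega>) \<le> s powr (- a) * indicator {0..A} (X n \<omega>) + (A\<^sup>2) powr (- a)"
      proof (cases "X n \<omega> \<le> A")
        case True
        then show ?thesis using lyap_le[of a s] a s X_nonneg[OF \<omega>] by (simp add: add_increasing2)
      next
        case False
        then have "A\<^sup>2 \<le> s + (X n \<omega>)\<^sup>2" using A s by (intro add_increasing power_mono) auto
        then have "lyap a s (X n \<omega>) \<le> (A\<^sup>2) powr (- a)"
          unfolding lyap_def using a A by (intro powr_mono2') auto
        then show ?thesis by (simp add: add_increasing)
      qed
    qed (use i in simp)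
    also have "\<dots> = s powr (- a) * ?p A n + (A\<^sup>2) powr (- a)"
      using i by (simp add: prob_space)
    finally show ?thesis .
  qed
  show "(\<lambda>n. \<integral>\<omega>. lyap a s (X n \<omega>) \<partial>M) \<longlonglongrightarrow> 0"
  proof (rule order_tendstoI)
    fix e :: real assume e: "0 < e"
    have "((\<lambda>A. (A\<^sup>2) powr (- a)) \<longlongrightarrow> 0) at_top"
      using a by (intro tendsto_neg_powr filterlim_pow_at_top filterlim_ident) auto
    then have "eventually (\<lambda>A. (A\<^sup>2) powr (- a) < e / 2) at_top"
      using e by (intro order_tendstoD) auto
    from eventually_happens'[OF _ eventually_conj[OF this eventually_gt_at_top[of 0]]]
    obtain A where A: "A > 0" "(A\<^sup>2) powr (- a) < e / 2"
      by auto
    have "(\<lambda>n. s powr (- a) * ?p A n) \<longlonglongrightarrow> s powr (- a) * 0"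
      by (intro tendsto_mult_left p)
    then have "eventually (\<lambda>n. s powr (- a) * ?p A n < e / 2) sequentially"
      using e by (intro order_tendstoD) auto
    then show "eventually (\<lambda>n. (\<integral>\<omega>. lyap a s (X n \<omega>) \<partial>M) < e) sequentially"
    proof eventually_elim
      case (elim n)
      then show ?case using le[OF A(1), of n] A(2) by linarith
    qed
  next
    fix e :: real assume "e < 0"
    moreover have "0 \<le> (\<integral>\<omega>. lyap a s (X n \<omega>) \<partial>M)" for n by (simp add: integral_nonneg_AE)
    ultimately show "eventually (\<lambda>n. (\<integral>\<omega>. lyap a s (X n \<omega>) \<partial>M) > e) sequentially"
      by (intro always_eventually allI) (rule less_le_trans)
  qed
qed

text \<open>
  The value of \<open>mean_quad\<close> with \<open>x m\<^sub>1(x)\<close> and \<open>m\<^sub>2(x)\<close> replaced by their limits.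
\<close>

definition limit_quad :: "real \<Rightarrow> real \<Rightarrow> real \<Rightarrow> real" where
  "limit_quad a s x = lyap (a + 1) s x *
     (2 * a * (a + 1) * (x\<^sup>2 / (s + x\<^sup>2)) * b - a * (2 * \<mu> + b))"

text \<open>
  On \<open>[0, A]\<close> the moments need not be close to their limits; there the error is merely bounded, and
  it will be negligible because the Green measure of \<open>[0, A]\<close> is a constant while \<open>s \<rightarrow> \<infinity>\<close>.
\<close>

lemma mean_quad_approx:
  assumes a: "a > 0" and \<kappa>: "\<kappa> > 0"
  obtains R A where "R \<ge> 0"
    "\<forall>s>0. \<forall>x\<ge>0. \<bar>mean_quad a s x - limit_quad a s x\<bar>
       \<le> lyap (a + 1) s x * (\<kappa> + R * indicator {0..A} x)"
proof -
  \<comment> \<open>The error does not depend on \<open>s\<close>, because \<open>x\<^sup>2/(s + x\<^sup>2) \<le> 1\<close>.\<close>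
  define E where "E x = 2 * a * (a + 1) * \<bar>m\<^sub>2 x - b\<bar> + a * (2 * \<bar>x * m\<^sub>1 x - \<mu>\<bar> + \<bar>m\<^sub>2 x - b\<bar>)" for x
  have "(E \<longlongrightarrow> 2 * a * (a + 1) * \<bar>b - b\<bar> + a * (2 * \<bar>\<mu> - \<mu>\<bar> + \<bar>b - b\<bar>)) at_top"
    unfolding E_def by (intro tendsto_intros m2 x_m1_tendsto)
  then have "eventually (\<lambda>x. E x < \<kappa>) at_top"
    using \<kappa> by (intro order_tendstoD) auto
  then obtain A0 where A0: "\<And>x. x \<ge> A0 \<Longrightarrow> E x < \<kappa>"
    by (auto simp: eventually_at_top_linorder)
  define A where "A = max A0 0"
  define R where "R = 2 * a * (a + 1) * (\<rho> 0 + b) + a * (2 * (A * (1 + \<rho> 0) + \<bar>\<mu>\<bar>) + (\<rho> 0 + b))"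
  have R: "R \<ge> 0" using a b_pos \<rho>0_nonneg by (simp add: R_def A_def)
  have E_le: "E x \<le> \<kappa> + R * indicator {0..A} x" if x: "x \<ge> 0" for x
  proof (cases "x \<le> A")
    case True
    have "\<bar>m\<^sub>2 x - b\<bar> \<le> \<rho> 0 + b" using m2_le[OF x] m2_nonneg[OF x] b_pos by simp
    moreover have "\<bar>x * m\<^sub>1 x - \<mu>\<bar> \<le> A * (1 + \<rho> 0) + \<bar>\<mu>\<bar>"
    proof -
      have "\<bar>x * m\<^sub>1 x\<bar> \<le> A * (1 + \<rho> 0)"
        unfolding abs_mult using True x m1_le[OF x] by (intro mult_mono) auto
      then show ?thesis by linarith
    qed
    ultimately have "E x \<le> R"
      unfolding E_def R_def using a by (intro add_mono mult_left_mono) auto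
    then show ?thesis using True x \<kappa> by simp
  next
    case False
    then have "E x < \<kappa>" by (intro A0) (simp add: A_def)
    then show ?thesis using False by simp
  qed
  show thesis
  proof (rule that[OF R], intro allI impI)
    fix s x :: real assume s: "s > 0" and x: "x \<ge> 0"
    define r where "r = x\<^sup>2 / (s + x\<^sup>2)"
    have r: "0 \<le> r" "r \<le> 1" using s by (auto simp: r_def divide_le_eq_1 add_pos_nonneg)
    have "mean_quad a s x - limit_quad a s x = lyap (a + 1) s x *
        (2 * a * (a + 1) * (r * (m\<^sub>2 x - b)) - a * (2 * (x * m\<^sub>1 x - \<mu>) + (m\<^sub>2 x - b)))"
      unfolding mean_quad_def limit_quad_def r_def[symmetric] by (simp add: algebra_simps)
    then have "\<bar>mean_quad a s x - limit_quad a s x\<bar> = lyap (a + 1) s x *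
        \<bar>2 * a * (a + 1) * (r * (m\<^sub>2 x - b)) - a * (2 * (x * m\<^sub>1 x - \<mu>) + (m\<^sub>2 x - b))\<bar>"
      by (simp add: abs_mult)
    also have "\<dots> \<le> lyap (a + 1) s x * E x"
    proof (intro mult_left_mono)
      have "\<bar>2 * a * (a + 1) * (r * (m\<^sub>2 x - b)) - a * (2 * (x * m\<^sub>1 x - \<mu>) + (m\<^sub>2 x - b))\<bar>
        \<le> \<bar>2 * a * (a + 1) * (r * (m\<^sub>2 x - b))\<bar> + \<bar>a * (2 * (x * m\<^sub>1 x - \<mu>) + (m\<^sub>2 x - b))\<bar>"
        by (rule abs_triangle_ineq4)
      also have "\<dots> = 2 * a * (a + 1) * (r * \<bar>m\<^sub>2 x - b\<bar>) + a * \<bar>2 * (x * m\<^sub>1 x - \<mu>) + (m\<^sub>2 x - b)\<bar>"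
        using a r by (simp add: abs_mult)
      also have "\<dots> \<le> E x"
      proof -
        have "\<bar>2 * (x * m\<^sub>1 x - \<mu>) + (m\<^sub>2 x - b)\<bar> \<le> 2 * \<bar>x * m\<^sub>1 x - \<mu>\<bar> + \<bar>m\<^sub>2 x - b\<bar>"
          using abs_triangle_ineq[of "2 * (x * m\<^sub>1 x - \<mu>)" "m\<^sub>2 x - b"] by (simp only: abs_mult abs_numeral)
        then show ?thesis
          unfolding E_def using a r by (intro add_mono mult_left_mono mult_left_le_one_le) auto
      qed
      finally show "\<bar>2 * a * (a + 1) * (r * (m\<^sub>2 x - b)) - a * (2 * (x * m\<^sub>1 x - \<mu>) + (m\<^sub>2 x - b))\<bar> \<le> E x" .
    qed simp
    also have "\<dots> \<le> lyap (a + 1) s x * (\<kappa> + R * indicator {0..A} x)"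
      by (intro mult_left_mono E_le x) simp
    finally show "\<bar>mean_quad a s x - limit_quad a s x\<bar> \<le> lyap (a + 1) s x * (\<kappa> + R * indicator {0..A} x)" .
  qed
qed

lemma generator_lyap_limit:
  assumes a: "d \<le> a" and \<kappa>: "\<kappa> > 0"
  obtains R A where "R \<ge> 0"
    "eventually (\<lambda>s. \<forall>x\<ge>0. \<bar>generator (lyap a s) x - limit_quad a s x\<bar>
       \<le> \<kappa> * (s powr (d - a) * lyap (d + 1) s x) + R * (s powr (- (a + 1)) * indicator {0..A} x)) at_top"
proof -
  have \<kappa>2: "\<kappa> / 2 > 0" and a0: "a > 0" using \<kappa> a d_bounds by auto
  obtain R A where R: "R \<ge> 0" and quad: "\<forall>s>0. \<forall>x\<ge>0. \<bar>mean_quad a s x - limit_quad a s x\<bar>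
       \<le> lyap (a + 1) s x * (\<kappa> / 2 + R * indicator {0..A} x)"
    using mean_quad_approx[OF a0 \<kappa>2] .
  show thesis
  proof (rule that[OF R])
    show "eventually (\<lambda>s. \<forall>x\<ge>0. \<bar>generator (lyap a s) x - limit_quad a s x\<bar>
       \<le> \<kappa> * (s powr (d - a) * lyap (d + 1) s x) + R * (s powr (- (a + 1)) * indicator {0..A} x)) at_top"
      using generator_lyap_approx[OF d_bounds(1,2) a \<kappa>2] eventually_gt_at_top[of 0]
    proof eventually_elim
      case (elim s)
      show ?case
      proof (intro allI impI)
        fix x :: real assume x: "x \<ge> 0"
        have "lyap (a + 1) s x * (\<kappa> / 2) \<le> (s powr (d - a) * lyap (d + 1) s x) * (\<kappa> / 2)"
          using \<kappa> lyap_exponent_le[of "d + 1" "a + 1" s x] a elim by (intro mult_right_mono) auto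
        moreover have "lyap (a + 1) s x * (R * indicator {0..A} x) \<le> s powr (- (a + 1)) * (R * indicator {0..A} x)"
          using R a0 elim by (intro mult_right_mono lyap_le) auto
        moreover have "\<bar>generator (lyap a s) x - mean_quad a s x\<bar> \<le> \<kappa> / 2 * (s powr (d - a) * lyap (d + 1) s x)"
          using elim x by auto
        moreover have "\<bar>mean_quad a s x - limit_quad a s x\<bar>
          \<le> lyap (a + 1) s x * (\<kappa> / 2) + lyap (a + 1) s x * (R * indicator {0..A} x)"
          using quad elim x by (simp add: distrib_left)
        moreover have "s powr (- (a + 1)) * (R * indicator {0..A} x) = R * (s powr (- (a + 1)) * indicator {0..A} x)"
          "(s powr (d - a) * lyap (d + 1) s x) * (\<kappa> / 2) = \<kappa> / 2 * (s powr (d - a) * lyap (d + 1) s x)"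
          "\<kappa> * (s powr (d - a) * lyap (d + 1) s x) = 2 * (\<kappa> / 2 * (s powr (d - a) * lyap (d + 1) s x))"
          by (simp_all add: ac_simps)
        ultimately show "\<bar>generator (lyap a s) x - limit_quad a s x\<bar>
           \<le> \<kappa> * (s powr (d - a) * lyap (d + 1) s x) + R * (s powr (- (a + 1)) * indicator {0..A} x)"
          by linarith
      qed
    qed
  qed
qed

definition J :: "real \<Rightarrow> real \<Rightarrow> real" where
  "J a s = s powr a * (\<integral>x. lyap (a + 1) s x \<partial>green)"

lemma limit_quad_eq:
  assumes "s > 0"
  shows "limit_quad a s x = - (2 * a * b * (q - a) * lyap (a + 1) s x + 2 * a * (a + 1) * b * s * lyap (a + 1 + 1) s x)"
proof -
  define t where "t = s + x\<^sup>2"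
  have t: "t > 0" "x\<^sup>2 = t - s" using assms by (auto simp: t_def add_pos_nonneg)
  have mu: "2 * \<mu> = 2 * b * q + b" by (simp add: q_eq)
  show ?thesis
    unfolding limit_quad_def lyap_plus_1[OF assms, of "a + 1"] t_def[symmetric] mu t(2)
    using t(1) by (simp add: field_simps)
qed

lemma integral_limit_quad:
  assumes "d \<le> a"
  shows "eventually (\<lambda>s. integrable green (limit_quad a s) \<and>
     s powr a * (\<integral>x. limit_quad a s x \<partial>green) = - (2 * a * b * (q - a) * J a s + 2 * a * (a + 1) * b * J (a + 1) s)) at_top"
proof -
  have "d \<le> a + 1" using assms by simp
  from lyap_integrable_green[OF assms] lyap_integrable_green[OF this] eventually_gt_at_top[of 0]
  show ?thesis
  proof eventually_elim
    case (elim s)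
    have "limit_quad a s = (\<lambda>x. - (2 * a * b * (q - a) * lyap (a + 1) s x + 2 * a * (a + 1) * b * s * lyap (a + 1 + 1) s x))"
      using limit_quad_eq elim by auto
    then show ?case
      using elim by (simp add: J_def powr_add algebra_simps)
  qed
qed

lemma initial_limit:
  assumes a: "a > 0"
  shows "((\<lambda>s. s powr a * (\<integral>\<omega>. lyap a s (X 0 \<omega>) \<partial>M)) \<longlongrightarrow> 1) at_top"
proof -
  have eq: "s powr a * lyap a s x = (s / (s + x\<^sup>2)) powr a" if "s > 0" for s x
    using that by (simp add: lyap_def powr_divide powr_minus divide_simps)
  have "((\<lambda>s. \<integral>\<omega>. s powr a * lyap a s (X 0 \<omega>) \<partial>M) \<longlongrightarrow> (\<integral>\<omega>. 1 \<partial>M)) at_top"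
  proof (rule integral_dominated_convergence_at_top[where w = "\<lambda>_. 1"])
    show "(\<lambda>\<omega>. s powr a * lyap a s (X 0 \<omega>)) \<in> borel_measurable M" for s
      by (intro borel_measurable_times measurable_compose[OF X_measurable lyap_borel]) simp
    show "eventually (\<lambda>s. AE \<omega> in M. norm (s powr a * lyap a s (X 0 \<omega>)) \<le> 1) at_top"
      using eventually_gt_at_top[of 0]
    proof eventually_elim
      case (elim s)
      have "(s / (s + x\<^sup>2)) powr a \<le> 1" for x
        using elim a by (intro powr_le1) (auto simp: divide_le_eq_1 add_pos_nonneg)
      then show ?case using elim by (simp add: eq)
    qed
    show "AE \<omega> in M. ((\<lambda>s. s powr a * lyap a s (X 0 \<omega>)) \<longlongrightarrow> 1) at_top"
    proof (rule AE_I2)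
      fix \<omega>
      define x where "x = X 0 \<omega>"
      have "((\<lambda>s. 1 / (1 + x\<^sup>2 / s)) \<longlongrightarrow> 1 / (1 + 0)) at_top"
        by (intro tendsto_intros tendsto_divide_0[OF tendsto_const] filterlim_at_top_imp_at_infinity filterlim_ident) simp
      moreover have "eventually (\<lambda>s. 1 / (1 + x\<^sup>2 / s) = s / (s + x\<^sup>2)) at_top"
        using eventually_gt_at_top[of 0] by eventually_elim (simp add: field_simps)
      ultimately have "((\<lambda>s. s / (s + x\<^sup>2)) \<longlongrightarrow> 1) at_top"
        using tendsto_cong by fastforce
      then have "((\<lambda>s. (s / (s + x\<^sup>2)) powr a) \<longlongrightarrow> 1 powr a) at_top"
        by (intro tendsto_powr) auto
      moreover have "eventually (\<lambda>s. (s / (s + x\<^sup>2)) powr a = s powr a * lyap a s x) at_top"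
        using eventually_gt_at_top[of 0] by eventually_elim (simp add: eq)
      ultimately show "((\<lambda>s. s powr a * lyap a s (X 0 \<omega>)) \<longlongrightarrow> 1) at_top"
        using tendsto_cong unfolding x_def by fastforce
    qed
  qed auto
  then show ?thesis by (simp add: prob_space)
qed

text \<open>
  The potential identity for \<open>lyap a s\<close>, multiplied by \<open>s\<^bsup>a\<^esup>\<close>, with the generator replaced by its limit.
\<close>

lemma J_relation:
  assumes a: "d \<le> a"
  shows "((\<lambda>s. 2 * a * b * (q - a) * J a s + 2 * a * (a + 1) * b * J (a + 1) s) \<longlongrightarrow> 1) at_top"
proof -
  have a0: "a > 0" using a d_bounds by simp
  obtain C where C: "C \<ge> 0" and G: "eventually (\<lambda>s. integrable green (lyap (d + 1) s) \<and> (\<integral>x. lyap (d + 1) s x \<partial>green) \<le> C * s powr (- d)) at_top"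
    using green_lyap_bound .
  define Err where "Err s = 2 * a * b * (q - a) * J a s + 2 * a * (a + 1) * b * J (a + 1) s
    - s powr a * (\<integral>\<omega>. lyap a s (X 0 \<omega>) \<partial>M)" for s
  have "(Err \<longlongrightarrow> 0) at_top"
  proof (rule tendstoI)
    fix e :: real assume e: "e > 0"
    \<comment> \<open>By the a priori bound an error of \<open>\<kappa> s\<^bsup>d-a\<^esup> lyap (d + 1) s\<close> integrates to at most \<open>\<kappa> C s\<^bsup>-a\<^esup>\<close>, and an
      error of order \<open>s\<^bsup>-a-1\<^esup>\<close> on a fixed interval is of smaller order.\<close>
    define \<kappa> where "\<kappa> = e / (2 * (C + 1))"
    have \<kappa>: "\<kappa> > 0" using C e by (simp add: \<kappa>_def)
    have \<kappa>C: "\<kappa> * C < e / 2"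
      using C e by (simp add: \<kappa>_def field_simps)
    obtain R A where R: "R \<ge> 0" and gen: "eventually (\<lambda>s. \<forall>x\<ge>0. \<bar>generator (lyap a s) x - limit_quad a s x\<bar>
       \<le> \<kappa> * (s powr (d - a) * lyap (d + 1) s x) + R * (s powr (- (a + 1)) * indicator {0..A} x)) at_top"
      using generator_lyap_limit[OF a \<kappa>] .
    define g where "g = (\<integral>x. indicat_real {0..A} x \<partial>green)"
    have "((\<lambda>s. R * g / s) \<longlongrightarrow> 0) at_top"
      by (intro tendsto_divide_0[OF tendsto_const] filterlim_at_top_imp_at_infinity filterlim_ident)
    then have small: "eventually (\<lambda>s. R * g / s < e / 2) at_top"
      using e by (intro order_tendstoD) auto
    show "eventually (\<lambda>s. dist (Err s) 0 < e) at_top"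
      using G gen small integral_limit_quad[OF a] eventually_gt_at_top[of 0]
    proof eventually_elim
      case (elim s)
      have s: "s > 0" using elim by simp
      define Bd where "Bd x = \<kappa> * (s powr (d - a) * lyap (d + 1) s x) + R * (s powr (- (a + 1)) * indicator {0..A} x)" for x
      have iB: "integrable green Bd"
        unfolding Bd_def using elim indicator_integrable_green[of A] by simp
      have lm: "limit_quad a s \<in> borel_measurable Rplus"
        using elim by (auto dest: borel_measurable_integrable)
      have iD: "integrable green (\<lambda>x. generator (lyap a s) x - limit_quad a s x)"
      proof (rule Bochner_Integration.integrable_bound[OF iB])
        show "(\<lambda>x. generator (lyap a s) x - limit_quad a s x) \<in> borel_measurable green"
          using lm by measurable
        show "AE x in green. norm (generator (lyap a s) x - limit_quad a s x) \<le> norm (Bd x)"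
          unfolding Bd_def real_norm_def using elim(2) by (intro AE_I2 order_trans[OF _ abs_ge_self]) simp
      qed
      have "integrable green (\<lambda>x. (generator (lyap a s) x - limit_quad a s x) + limit_quad a s x)"
        using iD elim by (intro Bochner_Integration.integrable_add) auto
      then have iG: "integrable green (generator (lyap a s))" by simp
      have pot: "(\<integral>x. generator (lyap a s) x \<partial>green) = - (\<integral>\<omega>. lyap a s (X 0 \<omega>) \<partial>M)"
        using a0 s by (intro potential_identity[where B = "s powr (- a)"] iG expectation_lyap_vanishes lyap_borel)
          (simp_all add: lyap_le)
      have "\<bar>\<integral>x. generator (lyap a s) x - limit_quad a s x \<partial>green\<bar> \<le> (\<integral>x. Bd x \<partial>green)"
        unfolding Bd_def
        using elim(2) by (intro order_trans[OF integral_abs_bound] integral_mono integrable_abs iD iB[unfolded Bd_def]) simp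
      also have "\<dots> = \<kappa> * (s powr (d - a) * (\<integral>x. lyap (d + 1) s x \<partial>green)) + R * (s powr (- (a + 1)) * g)"
        unfolding Bd_def g_def using elim indicator_integrable_green[of A] by simp
      also have "\<dots> \<le> \<kappa> * (s powr (d - a) * (C * s powr (- d))) + R * (s powr (- (a + 1)) * g)"
        using \<kappa> elim by (intro add_right_mono mult_left_mono) auto
      also have "\<dots> = s powr (- a) * (\<kappa> * C + R * g / s)"
        using s by (simp add: powr_diff powr_minus powr_add field_simps)
      finally have "\<bar>\<integral>x. generator (lyap a s) x - limit_quad a s x \<partial>green\<bar> \<le> s powr (- a) * (\<kappa> * C + R * g / s)" .
      from mult_left_mono[OF this, of "s powr a"]
      have le: "s powr a * \<bar>\<integral>x. generator (lyap a s) x - limit_quad a s x \<partial>green\<bar> \<le> \<kappa> * C + R * g / s"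
        using s by (simp flip: powr_add mult.assoc)
      have "Err s = s powr a * (\<integral>x. generator (lyap a s) x - limit_quad a s x \<partial>green)"
        using elim(4) iG by (simp add: Err_def pot right_diff_distrib)
      then have "\<bar>Err s\<bar> \<le> \<kappa> * C + R * g / s"
        using le by (simp add: abs_mult)
      then have "\<bar>Err s\<bar> < e" using \<kappa>C elim(3) by linarith
      then show ?case by simp
    qed
  qed
  from tendsto_add[OF this initial_limit[OF a0]] show ?thesis
    unfolding Err_def by simp
qed

text \<open>
  The relation between \<open>J a\<close> and \<open>J (a + 1)\<close> by itself does not determine a limit; it does so from \<open>a = q\<close> on,
  where the coefficient of \<open>J a\<close> is zero.
\<close>

lemma J_limit: "((\<lambda>s. J (q + 1 + real j) s) \<longlongrightarrow> 1 / (2 * b * q * (q + 1 + real j))) at_top"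
proof (induction j)
  case 0
  have "0 < 2 * q * (q + 1) * b" using q_pos b_pos by (intro mult_pos_pos add_pos_pos) simp_all
  then have nz: "2 * q * (q + 1) * b \<noteq> 0" by linarith
  have "d \<le> q" using d_bounds by simp
  from tendsto_divide[OF J_relation[OF this] tendsto_const nz]
  have "((\<lambda>s. (2 * q * b * (q - q) * J q s + 2 * q * (q + 1) * b * J (q + 1) s) / (2 * q * (q + 1) * b))
      \<longlongrightarrow> 1 / (2 * q * (q + 1) * b)) at_top" .
  also have "(\<lambda>s. (2 * q * b * (q - q) * J q s + 2 * q * (q + 1) * b * J (q + 1) s) / (2 * q * (q + 1) * b)) = J (q + 1)"
    using nz by simp
  also have "1 / (2 * q * (q + 1) * b) = 1 / (2 * b * q * (q + 1))"
    by (simp only: ac_simps)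
  finally show ?case by simp
next
  case (Suc j)
  define a where "a = q + 1 + real j"
  have a: "a > q" "a > 0" using q_pos by (auto simp: a_def)
  have "0 < 2 * a * (a + 1) * b" using a b_pos by (intro mult_pos_pos add_pos_pos) simp_all
  then have nz: "2 * a * (a + 1) * b \<noteq> 0" by linarith
  have "d \<le> a" using a d_bounds by simp
  note rel = J_relation[OF this]
  have IH: "(J a \<longlongrightarrow> 1 / (2 * b * q * a)) at_top"
    using Suc.IH by (simp add: a_def)
  have "((\<lambda>s. ((2 * a * b * (q - a) * J a s + 2 * a * (a + 1) * b * J (a + 1) s) - 2 * a * b * (q - a) * J a s)
      / (2 * a * (a + 1) * b)) \<longlongrightarrow> (1 - 2 * a * b * (q - a) * (1 / (2 * b * q * a))) / (2 * a * (a + 1) * b)) at_top"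
    by (rule tendsto_divide[OF tendsto_diff[OF rel tendsto_mult_left[OF IH]] tendsto_const nz])
  also have "(\<lambda>s. ((2 * a * b * (q - a) * J a s + 2 * a * (a + 1) * b * J (a + 1) s) - 2 * a * b * (q - a) * J a s)
      / (2 * a * (a + 1) * b)) = J (a + 1)"
    using nz by auto
  also have "(1 - 2 * a * b * (q - a) * (1 / (2 * b * q * a))) / (2 * a * (a + 1) * b) = 1 / (2 * b * q * (a + 1))"
  proof -
    have "1 - 2 * a * b * (q - a) * (1 / (2 * b * q * a)) = a / q"
      using a b_pos q_pos by (simp add: field_simps)
    then have "(1 - 2 * a * b * (q - a) * (1 / (2 * b * q * a))) / (2 * a * (a + 1) * b)
        = (a / q) / (a * (2 * (a + 1) * b))" by (simp add: mult_ac)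
    then show ?thesis using a by (simp add: mult_ac)
  qed
  finally show ?case by (simp add: a_def add_ac)
qed

end

section \<open>From moments to the renewal function\<close>

text \<open>
  By linearity the convergence extends from the moments to polynomials, which approximate \<open>h\<close> uniformly on
  \<open>[0, 1]\<close>. The zeroth moment keeps the masses bounded, so that the approximation error is uniform in \<open>s\<close>.
\<close>

lemma moment_limit_imp_weighted_limit:
  fixes \<phi> W :: "'s \<Rightarrow> 'x \<Rightarrow> real" and \<theta> h :: "real \<Rightarrow> real"
  assumes reg: "eventually (\<lambda>s. integrable G (\<phi> s) \<and> W s \<in> borel_measurable G \<and>
      (\<forall>x\<in>space G. 0 \<le> \<phi> s x \<and> 0 \<le> W s x \<and> W s x \<le> 1)) F"
    and mom: "\<And>j::nat. ((\<lambda>s. \<integral>x. \<phi> s x * W s x ^ j \<partial>G) \<longlongrightarrow> integral {0..1} (\<lambda>u. \<theta> u * u ^ j)) F"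
    and \<theta>: "continuous_on {0..1} \<theta>" "\<And>u. u \<in> {0..1} \<Longrightarrow> 0 \<le> \<theta> u"
    and h: "continuous_on UNIV h"
  shows "((\<lambda>s. \<integral>x. \<phi> s x * h (W s x) \<partial>G) \<longlongrightarrow> integral {0..1} (\<lambda>u. \<theta> u * h u)) F"
proof (rule tendstoI)
  fix e :: real assume e: "e > 0"
  define m where "m = integral {0..1} \<theta>"
  have m: "m \<ge> 0" unfolding m_def using \<theta> by (intro integral_nonneg integrable_continuous_real) auto
  \<comment> \<open>The masses converge to \<open>m\<close>, so they are eventually below \<open>m + 1\<close>, and approximating \<open>h\<close> within \<open>\<kappa>\<close>
    changes each integral by at most \<open>e/4\<close>.\<close>
  define \<kappa> where "\<kappa> = (e / 4) / (m + 1)"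
  have "m + 1 > 0" using m by simp
  then have \<kappa>: "\<kappa> > 0" "\<kappa> * (m + 1) = e / 4"
    using e nonzero_eq_divide_eq[THEN iffD1, OF _ \<kappa>_def] by (simp_all add: \<kappa>_def)
  have h01: "continuous_on {0..1} h" using h by (rule continuous_on_subset) simp
  obtain p where p: "real_polynomial_function p" and hp: "\<And>u. u \<in> {0..1} \<Longrightarrow> \<bar>h u - p u\<bar> < \<kappa>"
    using Stone_Weierstrass_real_polynomial_function[OF compact_Icc h01 \<kappa>(1)] by blast
  then obtain a n where p_eq: "p = (\<lambda>u. \<Sum>i\<le>n. a i * u ^ i)"
    unfolding real_polynomial_function_iff_sum by blast
  have p_cont: "continuous_on A p" for A
    unfolding p_eq by (intro continuous_intros)
  have h_meas: "h \<in> borel_measurable borel" "p \<in> borel_measurable borel"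
    using h p_cont by (auto intro: borel_measurable_continuous_onI)
  have poly_int: "integral {0..1} (\<lambda>u. \<theta> u * p u) = (\<Sum>i\<le>n. a i * integral {0..1} (\<lambda>u. \<theta> u * u ^ i))"
  proof -
    have "integral {0..1} (\<lambda>u. \<theta> u * p u) = integral {0..1} (\<lambda>u. \<Sum>i\<le>n. a i * (\<theta> u * u ^ i))"
      unfolding p_eq by (simp add: sum_distrib_left mult_ac)
    also have "\<dots> = (\<Sum>i\<le>n. integral {0..1} (\<lambda>u. a i * (\<theta> u * u ^ i)))"
      by (intro integral_sum integrable_continuous_real continuous_intros \<theta>) auto
    finally show ?thesis by simp
  qed
  have lim_err: "\<bar>integral {0..1} (\<lambda>u. \<theta> u * p u) - integral {0..1} (\<lambda>u. \<theta> u * h u)\<bar> \<le> \<kappa> * m"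
  proof -
    have "integral {0..1} (\<lambda>u. \<theta> u * p u) - integral {0..1} (\<lambda>u. \<theta> u * h u)
        = integral {0..1} (\<lambda>u. \<theta> u * p u - \<theta> u * h u)"
      by (intro integral_diff[symmetric] integrable_continuous_real continuous_intros \<theta> p_cont h01)
    also have "norm \<dots> \<le> integral {0..1} (\<lambda>u. \<kappa> * \<theta> u)"
    proof (rule integral_norm_bound_integral)
      show "norm (\<theta> u * p u - \<theta> u * h u) \<le> \<kappa> * \<theta> u" if "u \<in> {0..1}" for u
      proof -
        have "norm (\<theta> u * p u - \<theta> u * h u) = \<theta> u * \<bar>h u - p u\<bar>"
          using \<theta>(2)[OF that] by (simp add: abs_mult abs_minus_commute flip: right_diff_distrib)
        also have "\<dots> \<le> \<theta> u * \<kappa>"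
          using \<theta>(2)[OF that] hp[OF that] by (intro mult_left_mono) auto
        finally show ?thesis by (simp add: mult.commute)
      qed
    qed (intro integrable_continuous_real continuous_intros \<theta> p_cont h01)+
    finally show ?thesis by (simp add: m_def)
  qed
  have "((\<lambda>s. \<Sum>i\<le>n. a i * (\<integral>x. \<phi> s x * W s x ^ i \<partial>G)) \<longlongrightarrow> integral {0..1} (\<lambda>u. \<theta> u * p u)) F"
    unfolding poly_int by (intro tendsto_sum tendsto_mult_left mom)
  then have ev_poly: "eventually (\<lambda>s. dist (\<Sum>i\<le>n. a i * (\<integral>x. \<phi> s x * W s x ^ i \<partial>G))
      (integral {0..1} (\<lambda>u. \<theta> u * p u)) < e / 4) F"
    using e by (intro tendstoD) auto
  have "((\<lambda>s. \<integral>x. \<phi> s x \<partial>G) \<longlongrightarrow> m) F"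
    using mom[of 0] by (simp add: m_def)
  then have ev_mass: "eventually (\<lambda>s. (\<integral>x. \<phi> s x \<partial>G) < m + 1) F"
    by (rule order_tendstoD) simp
  show "eventually (\<lambda>s. dist (\<integral>x. \<phi> s x * h (W s x) \<partial>G) (integral {0..1} (\<lambda>u. \<theta> u * h u)) < e) F"
    using reg ev_poly ev_mass
  proof eventually_elim
    case (elim s)
    then have i: "integrable G (\<phi> s)" and W[measurable]: "W s \<in> borel_measurable G"
      and bd: "\<And>x. x \<in> space G \<Longrightarrow> 0 \<le> \<phi> s x \<and> 0 \<le> W s x \<and> W s x \<le> 1" by auto
    have [measurable]: "\<phi> s \<in> borel_measurable G" using i by auto
    note [measurable] = h_meas
    have i_pow: "integrable G (\<lambda>x. \<phi> s x * W s x ^ j)" for j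
    proof (rule Bochner_Integration.integrable_bound[OF i])
      show "AE x in G. norm (\<phi> s x * W s x ^ j) \<le> norm (\<phi> s x)"
        using bd by (intro AE_I2) (simp add: abs_mult mult_left_le power_le_one)
    qed simp
    then have i_p: "integrable G (\<lambda>x. \<phi> s x * p (W s x))"
      and p_int: "(\<integral>x. \<phi> s x * p (W s x) \<partial>G) = (\<Sum>i\<le>n. a i * (\<integral>x. \<phi> s x * W s x ^ i \<partial>G))"
      unfolding p_eq by (simp_all add: sum_distrib_left mult.left_commute)
    have bound: "\<bar>\<phi> s x * h (W s x) - \<phi> s x * p (W s x)\<bar> \<le> \<kappa> * \<phi> s x" if "x \<in> space G" for x
    proof -
      have "\<bar>\<phi> s x * h (W s x) - \<phi> s x * p (W s x)\<bar> = \<phi> s x * \<bar>h (W s x) - p (W s x)\<bar>"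
        using bd[OF that] by (simp add: abs_mult flip: right_diff_distrib)
      also have "\<dots> \<le> \<phi> s x * \<kappa>"
        using bd[OF that] hp[of "W s x"] by (intro mult_left_mono) auto
      finally show ?thesis by (simp add: mult.commute)
    qed
    have i_\<kappa>: "integrable G (\<lambda>x. \<kappa> * \<phi> s x)" using i by simp
    have i_d: "integrable G (\<lambda>x. \<phi> s x * h (W s x) - \<phi> s x * p (W s x))"
    proof (rule Bochner_Integration.integrable_bound[OF i_\<kappa>])
      show "AE x in G. norm (\<phi> s x * h (W s x) - \<phi> s x * p (W s x)) \<le> norm (\<kappa> * \<phi> s x)"
        unfolding real_norm_def by (intro AE_I2 order_trans[OF bound abs_ge_self])
    qed measurable
    have i_h: "integrable G (\<lambda>x. \<phi> s x * h (W s x))"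
      using Bochner_Integration.integrable_add[OF i_d i_p] by simp
    have "\<bar>(\<integral>x. \<phi> s x * h (W s x) \<partial>G) - (\<integral>x. \<phi> s x * p (W s x) \<partial>G)\<bar>
        = \<bar>\<integral>x. \<phi> s x * h (W s x) - \<phi> s x * p (W s x) \<partial>G\<bar>"
      using i_h i_p by simp
    also have "\<dots> \<le> (\<integral>x. \<kappa> * \<phi> s x \<partial>G)"
      by (intro order_trans[OF integral_abs_bound] integral_mono integrable_abs i_d i_\<kappa> bound)
    also have "\<dots> \<le> \<kappa> * (m + 1)"
      using \<kappa> elim(3) by (simp add: mult_left_mono)
    finally have "\<bar>(\<integral>x. \<phi> s x * h (W s x) \<partial>G) - (\<integral>x. \<phi> s x * p (W s x) \<partial>G)\<bar> \<le> e / 4"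
      using \<kappa> by simp
    moreover have "\<kappa> * m \<le> e / 4" using \<kappa> by (simp add: distrib_left)
    ultimately show ?case
      using elim(2) lim_err e unfolding p_int dist_real_def by linarith
  qed
qed

definition ramp :: "real \<Rightarrow> real \<Rightarrow> real \<Rightarrow> real" where
  "ramp l r w = min 1 (max 0 ((w - l) / (r - l)))"

lemma ramp_continuous: "l < r \<Longrightarrow> continuous_on A (ramp l r)"
  unfolding ramp_def by (intro continuous_intros) auto

lemma ramp_eq_0: "l < r \<Longrightarrow> w \<le> l \<Longrightarrow> ramp l r w = 0"
  and ramp_eq_1: "l < r \<Longrightarrow> r \<le> w \<Longrightarrow> ramp l r w = 1"
  and ramp_bounds: "0 \<le> ramp l r w" "ramp l r w \<le> 1"
  by (simp_all add: ramp_def max_absorb1 divide_nonpos_pos)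

lemma has_integral_inverse_square:
  fixes l :: real
  assumes "0 < l" "l \<le> 1"
  shows "((\<lambda>u. 1 / u\<^sup>2) has_integral (1 / l - 1)) {l..1}"
proof -
  have "((\<lambda>u. 1 / u\<^sup>2) has_integral (- (1 / 1) - (- (1 / l)))) {l..1}"
    using assms
    by (intro fundamental_theorem_of_calculus)
       (auto intro!: derivative_eq_intros simp flip: has_real_derivative_iff_has_vector_derivative
             simp: power2_eq_square)
  then show ?thesis by simp
qed

text \<open>
  The maximum with \<open>1/4\<close> only serves to make the integrand continuous at 0; on the support of the ramp the
  integrand is \<open>ramp l r u / u\<^sup>2\<close>, which lies between the functions \<open>1 / u\<^sup>2\<close> cut off at \<open>r\<close> and at \<open>l\<close>.
\<close>

lemma weighted_ramp_integral:
  fixes q l r :: real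
  assumes lr: "1/4 \<le> l" "l < r" "r \<le> 1" and q: "q > 0"
  defines "f \<equiv> (\<lambda>u. u powr q * (ramp l r u * max u (1/4) powr (- (q + 2))))"
  shows "1 / r - 1 \<le> integral {0..1} f" "integral {0..1} f \<le> 1 / l - 1"
proof -
  have cont: "continuous_on {0..1} f"
    unfolding f_def using q lr
    by (intro continuous_intros ramp_continuous continuous_on_powr') auto
  have int: "f integrable_on {c..d}" if "0 \<le> c" "d \<le> 1" for c d
    using that by (intro integrable_continuous_real continuous_on_subset[OF cont]) auto
  have f_eq: "f u = ramp l r u * (1 / u\<^sup>2)" if "1/4 \<le> u" for u
  proof -
    have "u powr q * max u (1/4) powr (- (q + 2)) = u powr (- 2)"
      using that by (simp add: max_absorb1 flip: powr_add)
    also have "\<dots> = 1 / u\<^sup>2" using that by (simp add: powr_minus divide_simps)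
    finally have "u powr q * max u (1/4) powr (- (q + 2)) = 1 / u\<^sup>2" .
    then have "ramp l r u * (u powr q * max u (1/4) powr (- (q + 2))) = ramp l r u * (1 / u\<^sup>2)"
      by (rule arg_cong)
    then show ?thesis unfolding f_def by (simp only: mult_ac)
  qed
  have f_nonneg: "f u \<ge> 0" for u by (simp add: f_def ramp_bounds)
  note inv = has_integral_inverse_square
  have "integral {0..1} f = integral {0..l} f + integral {l..1} f"
    using lr by (intro Henstock_Kurzweil_Integration.integral_combine[symmetric] int) auto
  also have "integral {0..l} f = integral {0..l} (\<lambda>_. 0)"
    using lr by (intro integral_cong) (simp add: f_def ramp_eq_0)
  also have "integral {l..1} f \<le> integral {l..1} (\<lambda>u. 1 / u\<^sup>2)"
  proof (rule integral_le)
    show "f u \<le> 1 / u\<^sup>2" if "u \<in> {l..1}" for u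
      using that lr by (subst f_eq) (auto simp: ramp_bounds divide_right_mono)
  qed (use lr int inv[of l] in \<open>auto simp: has_integral_integrable\<close>)
  also have "\<dots> = 1 / l - 1" using lr inv[of l] by (intro integral_unique) auto
  finally show "integral {0..1} f \<le> 1 / l - 1" by simp
  have "1 / r - 1 = integral {r..1} (\<lambda>u. 1 / u\<^sup>2)"
    using lr inv[of r] by (intro integral_unique[symmetric]) auto
  also have "\<dots> = integral {r..1} f"
    using lr by (intro integral_cong) (simp add: f_eq ramp_eq_1)
  also have "\<dots> \<le> integral {0..r} f + integral {r..1} f"
    using lr by (simp add: integral_nonneg int f_nonneg)
  also have "\<dots> = integral {0..1} f"
    using lr by (intro Henstock_Kurzweil_Integration.integral_combine int) auto
  finally show "1 / r - 1 \<le> integral {0..1} f" .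
qed

context lamperti_chain
begin

definition weight :: "real \<Rightarrow> real \<Rightarrow> real" where
  "weight s x = s / (s + x\<^sup>2)"

lemma weight_bounds:
  assumes "s > 0"
  shows "0 < weight s x" "weight s x \<le> 1"
  using assms by (auto simp: weight_def divide_le_eq_1 add_pos_nonneg)

lemma weight_powr:
  assumes "s > 0"
  shows "1 / s * weight s x powr (q + 2) * weight s x ^ j = s powr (q + 1 + j) * lyap (q + 1 + j + 1) s x"
proof -
  have t: "s + x\<^sup>2 > 0" using assms by (simp add: add_pos_nonneg)
  have "weight s x powr (q + 2) * weight s x ^ j = weight s x powr (q + 1 + j + 1)"
  proof -
    have "weight s x powr (q + 2) * weight s x ^ j = weight s x powr (q + 2) * weight s x powr real j"
      using weight_bounds[OF assms, of x] by (subst powr_realpow) auto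
    also have "\<dots> = weight s x powr (q + 2 + j)" by (rule powr_add[symmetric])
    also have "q + 2 + j = q + 1 + j + 1" by simp
    finally show ?thesis .
  qed
  also have "\<dots> = s powr (q + 1 + j + 1) * lyap (q + 1 + j + 1) s x"
    using assms t unfolding weight_def lyap_def powr_minus_divide by (subst powr_divide) simp_all
  also have "s powr (q + 1 + j + 1) = s * s powr (q + 1 + j)"
    using assms by (subst powr_add) simp
  finally show ?thesis using assms by (simp add: mult.assoc)
qed

lemma weighted_green_limit:
  assumes h: "continuous_on UNIV h"
  shows "((\<lambda>s. \<integral>x. 1 / s * weight s x powr (q + 2) * h (weight s x) \<partial>green) \<longlongrightarrow>
           1 / (2 * b * q) * integral {0..1} (\<lambda>u. u powr q * h u)) at_top"
proof -
  define c where "c = 1 / (2 * b * q)"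
  have c: "c \<ge> 0" using b_pos q_pos by (simp add: c_def)
  have "((\<lambda>s. \<integral>x. 1 / s * weight s x powr (q + 2) * h (weight s x) \<partial>green) \<longlongrightarrow>
           integral {0..1} (\<lambda>u. c * u powr q * h u)) at_top"
  proof (rule moment_limit_imp_weighted_limit[OF _ _ _ _ h])
    have "d \<le> q + 1 + real 0" using d_bounds by simp
    from lyap_integrable_green[OF this] eventually_gt_at_top[of 0]
    show "eventually (\<lambda>s. integrable green (\<lambda>x. 1 / s * weight s x powr (q + 2)) \<and>
        weight s \<in> borel_measurable green \<and>
        (\<forall>x\<in>space green. 0 \<le> 1 / s * weight s x powr (q + 2) \<and> 0 \<le> weight s x \<and> weight s x \<le> 1)) at_top"
    proof eventually_elim
      case (elim s)
      have "(\<lambda>x. 1 / s * weight s x powr (q + 2)) = (\<lambda>x. s powr (q + 1 + real 0) * lyap (q + 1 + real 0 + 1) s x)"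
        using weight_powr[of s _ 0] elim by auto
      moreover have "integrable green (\<lambda>x. s powr (q + 1 + real 0) * lyap (q + 1 + real 0 + 1) s x)"
        using elim by (intro integrable_mult_right) auto
      ultimately have "integrable green (\<lambda>x. 1 / s * weight s x powr (q + 2))" by simp
      moreover have "weight s \<in> borel_measurable green"
      proof -
        have "weight s \<in> borel_measurable Rplus"
          unfolding weight_def by (rule borel_measurable_Rplus) measurable
        then show ?thesis by simp
      qed
      ultimately show ?case
        using elim weight_bounds[of s] by (auto intro: less_imp_le)
    qed
    fix j :: nat
    have "integral {0..1} (\<lambda>u. c * u powr q * u ^ j) = c * integral {0..1} (\<lambda>u. u powr (q + j))"
    proof -
      have "integral {0..1} (\<lambda>u. c * u powr q * u ^ j) = integral {0..1} (\<lambda>u. c * u powr (q + j))"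
      proof (intro integral_cong)
        fix u :: real assume "u \<in> {0..1}"
        then show "c * u powr q * u ^ j = c * u powr (q + j)"
          using q_pos by (cases "u = 0") (auto simp: powr_add powr_realpow)
      qed
      then show ?thesis by simp
    qed
    also have "integral {0..1} (\<lambda>u. u powr (q + j)) = 1 / (q + j + 1)"
      using has_integral_powr_from_0[of "q + j" 1] q_pos by (intro integral_unique) simp
    finally have eq: "integral {0..1} (\<lambda>u. c * u powr q * u ^ j) = 1 / (2 * b * q * (q + 1 + j))"
      by (simp add: c_def add_ac)
    have "eventually (\<lambda>s. J (q + 1 + j) s = (\<integral>x. 1 / s * weight s x powr (q + 2) * weight s x ^ j \<partial>green)) at_top"
      using eventually_gt_at_top[of 0]
    proof eventually_elim
      case (elim s)
      then show ?case unfolding weight_powr[OF elim] J_def by simp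
    qed
    with J_limit[of j] show "((\<lambda>s. \<integral>x. 1 / s * weight s x powr (q + 2) * weight s x ^ j \<partial>green) \<longlongrightarrow>
        integral {0..1} (\<lambda>u. c * u powr q * u ^ j)) at_top"
      unfolding eq by (rule Lim_transform_eventually)
  next
    show "continuous_on {0..1} (\<lambda>u. c * u powr q)"
      using q_pos by (intro continuous_intros continuous_on_powr') auto
  qed (use c in auto)
  then show ?thesis by (simp add: c_def mult.assoc)
qed

lemma green_ramp_limit:
  assumes lr: "1/4 \<le> l" "l < r" "r \<le> 1"
  obtains L where "1 / (2 * b * q) * (1 / r - 1) \<le> L" "L \<le> 1 / (2 * b * q) * (1 / l - 1)"
    "((\<lambda>s. 1 / s * (\<integral>x. ramp l r (weight s x) \<partial>green)) \<longlongrightarrow> L) at_top"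
    "eventually (\<lambda>s. integrable green (\<lambda>x. ramp l r (weight s x))) at_top"
proof -
  define h where "h = (\<lambda>u. ramp l r u * max u (1/4) powr (- (q + 2)))"
  have h: "continuous_on UNIV h"
    unfolding h_def using lr by (intro continuous_intros ramp_continuous) auto
  have eq: "weight s x powr (q + 2) * h (weight s x) = ramp l r (weight s x)" if "s > 0" for s x
  proof (cases "weight s x \<le> 1/4")
    case True
    then show ?thesis using lr by (simp add: h_def ramp_eq_0)
  next
    case False
    then show ?thesis
      using powr_add[of "weight s x" "q + 2" "- (q + 2)"] weight_bounds[OF that, of x]
      by (simp add: h_def max_def mult.left_commute)
  qed
  show thesis
  proof (rule that)
    have "1 / (2 * b * q) \<ge> 0" using b_pos q_pos by simp
    then show "1 / (2 * b * q) * (1 / r - 1) \<le> 1 / (2 * b * q) * integral {0..1} (\<lambda>u. u powr q * h u)"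
      "1 / (2 * b * q) * integral {0..1} (\<lambda>u. u powr q * h u) \<le> 1 / (2 * b * q) * (1 / l - 1)"
      unfolding h_def using weighted_ramp_integral[OF lr q_pos] by (intro mult_left_mono; simp)+
    have "eventually (\<lambda>s. (\<integral>x. 1 / s * weight s x powr (q + 2) * h (weight s x) \<partial>green)
        = 1 / s * (\<integral>x. ramp l r (weight s x) \<partial>green)) at_top"
      using eventually_gt_at_top[of 0]
    proof eventually_elim
      case (elim s)
      then show ?case unfolding mult.assoc eq[OF elim] by simp
    qed
    with weighted_green_limit[OF h]
    show "((\<lambda>s. 1 / s * (\<integral>x. ramp l r (weight s x) \<partial>green)) \<longlongrightarrow>
        1 / (2 * b * q) * integral {0..1} (\<lambda>u. u powr q * h u)) at_top"
      by (rule Lim_transform_eventually)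
    show "eventually (\<lambda>s. integrable green (\<lambda>x. ramp l r (weight s x))) at_top"
      using eventually_gt_at_top[of 0]
    proof eventually_elim
      case (elim s)
      have "(\<lambda>x. ramp l r (weight s x)) \<in> borel_measurable Rplus"
        unfolding weight_def ramp_def by (rule borel_measurable_Rplus) measurable
      then have m: "(\<lambda>x. ramp l r (weight s x)) \<in> borel_measurable green" by simp
      show ?case
      \<comment> \<open>The ramp vanishes unless \<open>weight s x > 1/4\<close>, that is, \<open>x\<^sup>2 < 3s\<close>.\<close>
      proof (rule Bochner_Integration.integrable_bound[OF indicator_integrable_green[of "sqrt (3 * s)"] m])
        show "AE x in green. norm (ramp l r (weight s x)) \<le> norm (indicat_real {0..sqrt (3 * s)} x)"
        proof (rule AE_I2)
          fix x assume "x \<in> space green"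
          then have x: "x \<ge> 0" by simp
          show "norm (ramp l r (weight s x)) \<le> norm (indicat_real {0..sqrt (3 * s)} x)"
          proof (cases "x \<le> sqrt (3 * s)")
            case True
            then show ?thesis using x by (simp add: ramp_bounds)
          next
            case False
            then have "3 * s < x\<^sup>2" using real_le_rsqrt[of x "3 * s"] by linarith
            then have "weight s x \<le> 1/4" using elim by (simp add: weight_def field_simps)
            then show ?thesis using lr by (simp add: ramp_eq_0)
          qed
        qed
      qed
    qed
  qed
qed

text \<open>
  Since \<open>x\<^sup>2 \<le> s\<close> is equivalent to \<open>weight s x \<ge> 1/2\<close>, ramps ending and starting at \<open>1/2\<close> enclose the
  indicator of \<open>[0, \<surd>s]\<close>. Their limits enclose \<open>(1 / (1/2) - 1) / (2bq) = 1 / (2bq)\<close> ever more tightly as the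
  other endpoint approaches \<open>1/2\<close>.
\<close>

lemma green_square_limit:
  "((\<lambda>s. measure green {0..sqrt s} / s) \<longlongrightarrow> 1 / (2 * b * q)) at_top"
proof -
  define c where "c = 1 / (2 * b * q)"
  have ind: "(\<integral>x. indicat_real {0..A} x \<partial>green) = measure green {0..A}" for A
  proof -
    have "{0..A} \<inter> {0..} = {0..A}" by auto
    then show ?thesis by simp
  qed
  have le_iff: "x \<le> sqrt s \<longleftrightarrow> weight s x \<ge> 1/2" if "s > 0" "x \<ge> 0" for s x
  proof -
    have "x \<le> sqrt s \<longleftrightarrow> x\<^sup>2 \<le> s" using that real_sqrt_le_iff[of "x\<^sup>2" s] by simp
    also have "\<dots> \<longleftrightarrow> weight s x \<ge> 1/2"
      using that add_pos_nonneg[of s "x\<^sup>2"] by (simp add: weight_def field_simps)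
    finally show ?thesis .
  qed
  have upper: "eventually (\<lambda>s. measure green {0..sqrt s} / s < v) at_top" if v: "v > c" for v
  proof -
    have "((\<lambda>l. c * (1 / l - 1)) \<longlongrightarrow> c * (1 / (1/2) - 1)) (at_left (1/2))"
      by (intro tendsto_intros) auto
    then have ev: "eventually (\<lambda>l. c * (1 / l - 1) < v) (at_left (1/2))"
      using v by (intro order_tendstoD) auto
    have "eventually (\<lambda>l. l \<in> {1/4<..<1/2}) (at_left (1/2 :: real))"
      by (intro eventually_at_leftI[of "1/4"]) auto
    from eventually_happens'[OF trivial_limit_at_left_real eventually_conj[OF ev this]]
    obtain l where l: "c * (1 / l - 1) < v" "1/4 < l" "l < 1/2"
      by auto
    obtain L where L: "L \<le> c * (1 / l - 1)"
      and lim: "((\<lambda>s. 1 / s * (\<integral>x. ramp l (1/2) (weight s x) \<partial>green)) \<longlongrightarrow> L) at_top"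
      and int: "eventually (\<lambda>s. integrable green (\<lambda>x. ramp l (1/2) (weight s x))) at_top"
      using green_ramp_limit[of l "1/2"] l unfolding c_def by auto
    have "eventually (\<lambda>s. 1 / s * (\<integral>x. ramp l (1/2) (weight s x) \<partial>green) < v) at_top"
      using L l by (intro order_tendstoD(2)[OF lim]) linarith
    with int eventually_gt_at_top[of 0] show ?thesis
    proof eventually_elim
      case (elim s)
      have "(\<integral>x. indicat_real {0..sqrt s} x \<partial>green) \<le> (\<integral>x. ramp l (1/2) (weight s x) \<partial>green)"
        using elim l le_iff
        by (intro integral_mono indicator_integrable_green) (auto simp: indicator_def ramp_eq_1 ramp_bounds)
      then have "measure green {0..sqrt s} / s \<le> (\<integral>x. ramp l (1/2) (weight s x) \<partial>green) / s"
        unfolding ind using elim by (intro divide_right_mono) auto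
      then show ?case using elim by simp
    qed
  qed
  have lower: "eventually (\<lambda>s. v < measure green {0..sqrt s} / s) at_top" if v: "v < c" for v
  proof -
    have "((\<lambda>r. c * (1 / r - 1)) \<longlongrightarrow> c * (1 / (1/2) - 1)) (at_right (1/2))"
      by (intro tendsto_intros) auto
    then have ev: "eventually (\<lambda>r. v < c * (1 / r - 1)) (at_right (1/2))"
      using v by (intro order_tendstoD) auto
    have "eventually (\<lambda>r. r \<in> {1/2<..<1}) (at_right (1/2 :: real))"
      by (intro eventually_at_rightI[of _ 1]) auto
    from eventually_happens'[OF trivial_limit_at_right_real eventually_conj[OF ev this]]
    obtain r where r: "v < c * (1 / r - 1)" "1/2 < r" "r < 1"
      by auto
    obtain L where L: "c * (1 / r - 1) \<le> L"
      and lim: "((\<lambda>s. 1 / s * (\<integral>x. ramp (1/2) r (weight s x) \<partial>green)) \<longlongrightarrow> L) at_top"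
      and int: "eventually (\<lambda>s. integrable green (\<lambda>x. ramp (1/2) r (weight s x))) at_top"
      using green_ramp_limit[of "1/2" r] r unfolding c_def by auto
    have "eventually (\<lambda>s. v < 1 / s * (\<integral>x. ramp (1/2) r (weight s x) \<partial>green)) at_top"
      using L r by (intro order_tendstoD(1)[OF lim]) linarith
    with int eventually_gt_at_top[of 0] show ?thesis
    proof eventually_elim
      case (elim s)
      have "(\<integral>x. ramp (1/2) r (weight s x) \<partial>green) \<le> (\<integral>x. indicat_real {0..sqrt s} x \<partial>green)"
        using elim r le_iff
        by (intro integral_mono indicator_integrable_green) (auto simp: indicator_def ramp_eq_0 ramp_bounds)
      then have "(\<integral>x. ramp (1/2) r (weight s x) \<partial>green) / s \<le> measure green {0..sqrt s} / s"
        unfolding ind using elim by (intro divide_right_mono) auto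
      then show ?case using elim by simp
    qed
  qed
  show ?thesis
    using upper lower unfolding c_def by (intro order_tendstoI) auto
qed

lemma renewal_asymptotics: "(\<lambda>x. enn2real (renewal_fun M X x)) \<sim>[at_top] (\<lambda>x. x\<^sup>2 / (2 * \<mu> - b))"
proof (rule asymp_equivI')
  have "filterlim (\<lambda>x::real. x\<^sup>2) at_top at_top"
    by (intro filterlim_pow_at_top filterlim_ident) auto
  from filterlim_compose[OF green_square_limit this]
  have "((\<lambda>x. (2 * b * q) * (measure green {0..sqrt (x\<^sup>2)} / x\<^sup>2)) \<longlongrightarrow> (2 * b * q) * (1 / (2 * b * q))) at_top"
    by (intro tendsto_mult_left)
  then have "((\<lambda>x. (2 * b * q) * (measure green {0..sqrt (x\<^sup>2)} / x\<^sup>2)) \<longlongrightarrow> 1) at_top"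
    using b_pos q_pos by simp
  moreover have "eventually (\<lambda>x. (2 * b * q) * (measure green {0..sqrt (x\<^sup>2)} / x\<^sup>2)
      = enn2real (renewal_fun M X x) / (x\<^sup>2 / (2 * \<mu> - b))) at_top"
    using eventually_gt_at_top[of 0]
  proof eventually_elim
    case (elim x)
    then show ?case
      by (simp add: measure_def emeasure_green_Icc renewal_fun_def q_eq)
  qed
  ultimately show "((\<lambda>x. enn2real (renewal_fun M X x) / (x\<^sup>2 / (2 * \<mu> - b))) \<longlongrightarrow> 1) at_top"
    by (rule Lim_transform_eventually)
qed

end

theorem theorem5:
  fixes M :: "'a measure" and N :: "'b measure" and K :: "real \<Rightarrow> real measure"
    and X :: "nat \<Rightarrow> 'a \<Rightarrow> real" and \<Xi> :: "'b \<Rightarrow> real"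
    and \<mu> b \<delta> \<gamma> x0 \<epsilon>0 \<epsilon> :: real
  assumes chain: "markov_chain M K X"
    and m1: "jump_moment K 1 \<sim>[at_top] (\<lambda>x. \<mu> / x)"
    and m2: "(jump_moment K 2 \<longlongrightarrow> b) at_top"
    and b_pos: "b > 0"
    and mu_b: "2 * \<mu> > b"
    and \<delta>: "\<delta> > 0"
    and \<gamma>: "0 < \<gamma>" "\<gamma> < 1"
    and \<delta>\<gamma>: "(1 + \<delta>) / (1 - \<gamma>) powr (2 + \<delta>) < 2 * \<mu> / b"
    and left_tail: "(\<lambda>x. measure (jump_law K x) {z. z \<le> - \<gamma> * x})
          \<in> o[at_top](\<lambda>x. jump_moment K 2 x / x powr (2 + \<delta>))"
    and params: "x0 \<ge> 0" "\<epsilon>0 \<ge> 0" "\<epsilon> > 0"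
    and drift: "\<And>x. x \<ge> 0 \<Longrightarrow>
          2 * x * jump_moment K 1 x + jump_moment K 2 x \<ge> (if x > x0 then \<epsilon> else - \<epsilon>0)"
    and occupation: "(SUP y\<in>{0..x0}. \<Sum>n. emeasure (law_from K n y) {0..x0}) < \<infinity>"
    and \<Xi>: "prob_space N" "integrable N \<Xi>"
    and domination: "\<And>x. x \<ge> 0 \<Longrightarrow> st_le (jump_law K x) (\<lambda>z. z\<^sup>2) N \<Xi>"
  shows "(\<lambda>x. enn2real (renewal_fun M X x)) \<sim>[at_top] (\<lambda>x. x\<^sup>2 / (2 * \<mu> - b))"
proof -
  interpret lamperti_chain M K X N \<Xi> \<mu> b \<delta> \<gamma> x0 \<epsilon>0 \<epsilon>
    by (intro lamperti_chain.intro half_line_chain.intro lamperti_chain_axioms.intro) (fact assms)+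
  show ?thesis by (rule renewal_asymptotics)
qed

end
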